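(* Let $\alpha\in(0,2)$, let $V:\mathbb{S}\to\mathbb{R}$ be a $C^5$ function on the unit circle $\mathbb{S}=\{z\in\mathbb{C}:|z|=1\}$ which is not identically constant, and put $W(x)=V(e^{ix})$, $x\in\mathbb{R}$. Let $X$ be the symmetric $\alpha$-stable Lévy process on $\mathbb{R}$, let $(Y_t,S_t)$ be the (unique strong) solution of $$dY_t=dX_t+W'(Y_t)S_t\,dt,\qquad dS_t=W''(Y_t)\,dt,$$ and let $Z_t=e^{iY_t}$. Let $$\pi(dz,ds)=\frac{1}{(2\pi)^{3/2}}\,e^{-s^2/2}\,dz\,ds,\qquad z\in\mathbb{S},\ s\in\mathbb{R}.$$ Then $\pi$ is a stationary distribution of the process $(Z_t,S_t)$.
   Context: $X$ is the symmetric $\alpha$-stable Lévy process on $\mathbb{R}$ started at $0$, with Lévy (jump) measure $\mathcal{A}_\alpha|x|^{-1-\alpha}dx$, $\mathcal{A}_\alpha=\alpha\,\Gamma\left(\frac{1+\alpha}{2}\right)\frac{2^{\alpha-1}}{\sqrt{\pi}\,\Gamma(1-\alpha/2)}$. $V\in C^5(\mathbb{S})$ means that $W(x)=V(e^{ix})$ is $C^5$ on $\mathbb{R}$. The SDE has a unique strong solution for every starting point $(Y_0,S_0)=(y,s)\in\mathbb{R}^2$; it is a non-exploding càdlàg strong Markov process. Since $W$ is $2\pi$-periodic, $(Z_t,S_t)=(e^{iY_t},S_t)$ is a strong Markov process on $\mathbb{S}\times\mathbb{R}$ with transition function $P^{\mathbb{S}}_t((e^{iy},s),B)=\mathbb{P}^{(y,s)}((e^{iY_t},S_t)\in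 B)$, $B\subset\mathbb{S}\times\mathbb{R}$ Borel. $dz$ denotes arc length measure on $\mathbb{S}$ (total mass $2\pi$). A probability measure $\mu$ on $\mathbb{S}\times\mathbb{R}$ is a stationary distribution if $\int P_t^{\mathbb{S}}(u,B)\,\mu(du)=\mu(B)$ for all $t\ge0$ and all Borel $B$. *)

theory Defs
  imports "HOL-Probability.Probability"
begin

section \<open>Levy processes\<close>

definition cadlag :: "(real \<Rightarrow> real) \<Rightarrow> bool" where
  "cadlag f \<longleftrightarrow>
     (\<forall>t\<ge>0. continuous (at_right t) f) \<and> (\<forall>t>0. \<exists>l. (f \<longlongrightarrow> l) (at_left t))"

text \<open>Processes are indexed by all reals, but only times \<open>t \<ge> 0\<close> matter.\<close>

definition levy_process :: "'a measure \<Rightarrow> (real \<Rightarrow> 'a \<Rightarrow> real) \<Rightarrow> bool" where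
  "levy_process M X \<longleftrightarrow>
     prob_space M \<and>
     (\<forall>t\<ge>0. X t \<in> borel_measurable M) \<and>
     (AE \<omega> in M. X 0 \<omega> = 0) \<and>
     (\<forall>(n::nat) (t::nat \<Rightarrow> real). 0 \<le> t 0 \<longrightarrow> (\<forall>i<n. t i \<le> t (Suc i)) \<longrightarrow>
        prob_space.indep_vars M (\<lambda>_. borel) (\<lambda>i \<omega>. X (t (Suc i)) \<omega> - X (t i) \<omega>) {..<n}) \<and>
     (\<forall>s t. 0 \<le> s \<longrightarrow> s \<le> t \<longrightarrow>
        distr M borel (\<lambda>\<omega>. X t \<omega> - X s \<omega>) = distr M borel (X (t - s))) \<and>
     (AE \<omega> in M. cadlag (\<lambda>t. X t \<omega>))"

text \<open>The Levy-Khintchine exponent with drift \<open>b\<close>, Gaussian variance \<open>v\<close> and Levy measure \<open>\<nu>\<close>.\<close>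

definition levy_exponent :: "real \<Rightarrow> real \<Rightarrow> real measure \<Rightarrow> real \<Rightarrow> complex" where
  "levy_exponent b v \<nu> u =
     \<i> * complex_of_real (b * u) - complex_of_real (v * u\<^sup>2 / 2) +
     (CLINT x|\<nu>. iexp (u * x) - 1 - \<i> * complex_of_real (u * x * indicator {-1..1} x))"

definition levy_process_with_triplet ::
    "'a measure \<Rightarrow> (real \<Rightarrow> 'a \<Rightarrow> real) \<Rightarrow> real \<Rightarrow> real \<Rightarrow> real measure \<Rightarrow> bool" where
  "levy_process_with_triplet M X b v \<nu> \<longleftrightarrow>
     levy_process M X \<and>
     (\<forall>t\<ge>0. \<forall>u. char (distr M borel (X t)) u = exp (complex_of_real t * levy_exponent b v \<nu> u))"

definition stable_const :: "real \<Rightarrow> real" where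
  "stable_const \<alpha> =
     \<alpha> * Gamma ((1 + \<alpha>) / 2) * (2 powr (\<alpha> - 1) / (sqrt pi * Gamma (1 - \<alpha> / 2)))"

definition stable_levy_measure :: "real \<Rightarrow> real measure" where
  "stable_levy_measure \<alpha> =
     density lborel (\<lambda>x. ennreal (stable_const \<alpha> * \<bar>x\<bar> powr (- 1 - \<alpha>)))"

definition symmetric_stable_process :: "real \<Rightarrow> 'a measure \<Rightarrow> (real \<Rightarrow> 'a \<Rightarrow> real) \<Rightarrow> bool" where
  "symmetric_stable_process \<alpha> M X \<longleftrightarrow>
     levy_process_with_triplet M X 0 0 (stable_levy_measure \<alpha>)"

section \<open>The stochastic differential equation\<close>

definition Ck_on_real :: "nat \<Rightarrow> (real \<Rightarrow> real) \<Rightarrow> bool" where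
  "Ck_on_real k f \<longleftrightarrow>
     (\<forall>j<k. \<forall>x. (deriv ^^ j) f differentiable (at x)) \<and> continuous_on UNIV ((deriv ^^ k) f)"

definition natural_filtration ::
    "'a measure \<Rightarrow> (real \<Rightarrow> 'a \<Rightarrow> real) \<Rightarrow> real \<Rightarrow> 'a measure" where
  "natural_filtration M X t =
     sigma (space M) {X r -` A \<inter> space M | r A. 0 \<le> r \<and> r \<le> t \<and> A \<in> sets borel}"

text \<open>Adaptedness to the filtration of \<open>X\<close> augmented by the \<open>M\<close>-null sets.\<close>

definition adapted_to_noise ::
    "'a measure \<Rightarrow> (real \<Rightarrow> 'a \<Rightarrow> real) \<Rightarrow> (real \<Rightarrow> 'a \<Rightarrow> real) \<Rightarrow> bool" where
  "adapted_to_noise M X Y \<longleftrightarrow>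
     (\<forall>t\<ge>0. \<exists>Y'\<in>borel_measurable (natural_filtration M X t). AE \<omega> in M. Y t \<omega> = Y' \<omega>)"

text \<open>
  Strong solutions, started at \<open>(y, s)\<close>, of
  \<open>dY = dX + W'(Y) S dt\<close>, \<open>dS = W''(Y) dt\<close>. The noise is additive, so the equation is the
  pathwise integral equation below; its integrands are bounded on compact time intervals because
  \<open>Y\<close> and \<open>S\<close> are cadlag.
\<close>

definition sde_solution ::
    "'a measure \<Rightarrow> (real \<Rightarrow> 'a \<Rightarrow> real) \<Rightarrow> (real \<Rightarrow> real) \<Rightarrow> real \<Rightarrow> real \<Rightarrow>
     (real \<Rightarrow> 'a \<Rightarrow> real) \<Rightarrow> (real \<Rightarrow> 'a \<Rightarrow> real) \<Rightarrow> bool" where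
  "sde_solution M X W y s Y S \<longleftrightarrow>
     (\<forall>t\<ge>0. Y t \<in> borel_measurable M \<and> S t \<in> borel_measurable M) \<and>
     adapted_to_noise M X Y \<and> adapted_to_noise M X S \<and>
     (AE \<omega> in M. cadlag (\<lambda>t. Y t \<omega>) \<and> cadlag (\<lambda>t. S t \<omega>)) \<and>
     (AE \<omega> in M. \<forall>t\<ge>0.
        ((\<lambda>r. deriv W (Y r \<omega>) * S r \<omega>) has_integral (Y t \<omega> - y - X t \<omega>)) {0..t} \<and>
        ((\<lambda>r. deriv (deriv W) (Y r \<omega>)) has_integral (S t \<omega> - s)) {0..t})"

section \<open>The process on the cylinder\<close>

definition circle_borel :: "complex measure" where
  "circle_borel = restrict_space borel (sphere 0 1)"

definition cylinder_borel :: "(complex \<times> real) measure" where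
  "cylinder_borel = circle_borel \<Otimes>\<^sub>M borel"

definition arc_length :: "complex measure" where
  "arc_length = distr (restrict_space lborel {0..<2 * pi}) circle_borel cis"

text \<open>
  Here \<open>Y y s\<close>, \<open>S y s\<close> is the solution started at \<open>(y, s)\<close>, and the result is the law of
  \<open>(exp (\<i> Y\<^sub>t), S\<^sub>t)\<close> started at \<open>(z, s)\<close>. For \<open>y\<close> we pick the representative \<open>Arg z\<close> of the
  angles with \<open>cis y = z\<close>; any other representative gives the same law, since \<open>W\<close> is
  \<open>2\<pi>\<close>-periodic and solutions are unique.
\<close>

definition cylinder_transition ::
    "'a measure \<Rightarrow> (real \<Rightarrow> real \<Rightarrow> real \<Rightarrow> 'a \<Rightarrow> real) \<Rightarrow> (real \<Rightarrow> real \<Rightarrow> real \<Rightarrow> 'a \<Rightarrow> real) \<Rightarrow>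
     real \<Rightarrow> complex \<times> real \<Rightarrow> (complex \<times> real) measure" where
  "cylinder_transition M Y S t = (\<lambda>(z, s).
     distr M cylinder_borel (\<lambda>\<omega>. (cis (Y (Arg z) s t \<omega>), S (Arg z) s t \<omega>)))"

text \<open>
  Measurability in the starting point is demanded because \<open>nn_integral\<close> of a non-measurable function
  is only a lower integral.
\<close>

definition stationary_distribution ::
    "'b measure \<Rightarrow> (real \<Rightarrow> 'b \<Rightarrow> 'b measure) \<Rightarrow> 'b measure \<Rightarrow> bool" where
  "stationary_distribution E P \<mu> \<longleftrightarrow>
     prob_space \<mu> \<and> sets \<mu> = sets E \<and>
     (\<forall>t\<ge>0. \<forall>B\<in>sets E.
        (\<lambda>u. emeasure (P t u) B) \<in> borel_measurable E \<and>
        (\<integral>\<^sup>+u. emeasure (P t u) B \<partial>\<mu>) = emeasure \<mu> B)"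

definition cylinder_gauss :: "(complex \<times> real) measure" where
  "cylinder_gauss =
     density (arc_length \<Otimes>\<^sub>M lborel)
       (\<lambda>(z, s). ennreal (1 / (2 * pi) powr (3 / 2) * exp (- s\<^sup>2 / 2)))"

end

theory Submission
  imports Defs "HOL-Library.Periodic_Fun"
begin

text \<open>
  The stationarity holds realisation by realisation of the noise. The drift
  \<open>b(y, s) = (W'(y) s, W''(y))\<close> satisfies \<open>div (b exp (-s\<^sup>2/2)) = 0\<close>, so its flow preserves
  \<open>exp (-s\<^sup>2/2) dy ds\<close>; the additive noise only translates \<open>y\<close>, which preserves this measure too.
  Since \<open>X\<close> may jump, the solution is obtained as the limit of a symplectic Euler scheme: a
  translation of \<open>y\<close>, a shear in \<open>s\<close>, a shear in \<open>y\<close>. Substitution in \<open>y\<close> and the Cameron-Martin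
  formula in \<open>s\<close> show that a step of length \<open>h\<close> changes integrals of test functions by only \<open>O(h\<^sup>2)\<close>,
  so the total change tends to \<open>0\<close>. The scheme is jointly measurable in the starting point and the
  realisation, hence Fubini's theorem turns the pathwise invariance into stationarity.
\<close>

section \<open>Convergence of the Euler scheme\<close>

text \<open>Each starting point comes with its own solution and its own exceptional null set, so no
  flow map with a computable Jacobian is at hand, and jumps make the equation for Y - X
  discontinuous in time. The scheme replaces the flow by explicit maps. In a step s moves first, by
  h W''(y); y then moves with the new s, by h s W'(y). With x = h W''(y), the density ratio of the
  first shear is exp(-s x - x^2/2) and the Jacobian of the second is 1 + (s + x) x. Their
  first-order terms cancel: this is the discrete form of the divergence identity. The distortion is
  uniformly small only for bounded s, which forces test functions vanishing for large s; s moves by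
  at most h C per step, so over time t the support widens by at most t C. The two limits differ in
  kind: convergence to the solution has no rate and holds almost surely for each starting point,
  while the invariance defect is bounded uniformly in the realisation. Integrating in the two
  possible orders lets both be used at once.\<close>

definition euler_step :: "(real \<Rightarrow> real) \<Rightarrow> (real \<Rightarrow> real) \<Rightarrow> real \<Rightarrow> real \<times> real \<Rightarrow> real \<times> real" where
  "euler_step w1 w2 h = (\<lambda>(y, s). (y + h * (s + h * w2 y) * w1 y, s + h * w2 y))"

text \<open>\<open>x k\<close> is the noise at the \<open>k\<close>-th grid point; its increment is added before the drift acts.\<close>

primrec euler ::
    "(real \<Rightarrow> real) \<Rightarrow> (real \<Rightarrow> real) \<Rightarrow> real \<Rightarrow> (nat \<Rightarrow> real) \<Rightarrow> nat \<Rightarrow>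
     real \<times> real \<Rightarrow> real \<times> real" where
  "euler w1 w2 h x 0 p = p"
| "euler w1 w2 h x (Suc k) p =
     euler_step w1 w2 h (fst (euler w1 w2 h x k p) + (x (Suc k) - x k), snd (euler w1 w2 h x k p))"

text \<open>Each step costs a factor \<open>1 + q\<close>, at most \<open>exp q\<close>. The source
  terms are kept as a sum and not replaced by a maximum, because they will be integrals over grid
  cells that add up to one integral over the whole time interval.\<close>

lemma discrete_gronwall:
  fixes e c :: "nat \<Rightarrow> real"
  assumes "e 0 = 0" "0 \<le> q" "\<And>k. k < n \<Longrightarrow> 0 \<le> c k"
    and step: "\<And>k. k < n \<Longrightarrow> e (Suc k) \<le> (1 + q) * e k + c k"
    and "k \<le> n"
  shows "e k \<le> exp (q * real k) * (\<Sum>j<k. c j)"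
  using \<open>k \<le> n\<close>
proof (induction k)
  case 0
  then show ?case using assms by simp
next
  case (Suc k)
  have nn: "0 \<le> (\<Sum>j<k. c j)" "0 \<le> c k"
    using Suc.prems assms(3) by (auto intro!: sum_nonneg)
  have "e (Suc k) \<le> (1 + q) * e k + c k"
    using step Suc.prems by simp
  also have "\<dots> \<le> exp q * (exp (q * real k) * (\<Sum>j<k. c j)) + exp (q * real (Suc k)) * c k"
  proof (rule add_mono)
    have "(1 + q) * e k \<le> (1 + q) * (exp (q * real k) * (\<Sum>j<k. c j))"
      using Suc assms(2) by (intro mult_left_mono) auto
    also have "\<dots> \<le> exp q * (exp (q * real k) * (\<Sum>j<k. c j))"
      using nn by (intro mult_right_mono exp_ge_add_one_self) auto
    finally show "(1 + q) * e k \<le> exp q * (exp (q * real k) * (\<Sum>j<k. c j))" .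
    have "1 * c k \<le> exp (q * real (Suc k)) * c k"
      using nn assms(2) by (intro mult_right_mono) auto
    then show "c k \<le> exp (q * real (Suc k)) * c k" by simp
  qed
  also have "\<dots> = exp (q * real (Suc k)) * (\<Sum>j<Suc k. c j)"
    by (simp add: algebra_simps exp_add)
  finally show ?case .
qed

text \<open>
  Comparing \<open>Y r\<close> with the value at the next rather than the previous grid point makes right
  continuity sufficient for convergence at every \<open>r\<close>, jump times included.
\<close>

definition next_grid :: "real \<Rightarrow> real \<Rightarrow> real" where
  "next_grid h r = (of_int \<lfloor>r / h\<rfloor> + 1) * h"

lemma next_grid_bounds:
  assumes "0 < h"
  shows "r < next_grid h r" "next_grid h r \<le> r + h"
proof -
  have "r / h < of_int \<lfloor>r / h\<rfloor> + 1" "of_int \<lfloor>r / h\<rfloor> \<le> r / h" by linarith+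
  from mult_strict_right_mono[OF this(1) assms] mult_right_mono[OF this(2), of h]
  show "r < next_grid h r" "next_grid h r \<le> r + h"
    using assms by (simp_all add: next_grid_def algebra_simps)
qed

lemma next_grid_eq:
  assumes "0 < h" "real k * h \<le> r" "r < real (Suc k) * h"
  shows "next_grid h r = real (Suc k) * h"
proof -
  have "\<lfloor>r / h\<rfloor> = int k"
    using assms by (intro floor_unique) (auto simp: field_simps)
  then show ?thesis by (simp add: next_grid_def)
qed

text \<open>The function factors through the integer floor of r / h, and every function on a
  discrete space is measurable. So \<open>f\<close> may be a path about which nothing is known
  yet.\<close>

lemma next_grid_measurable:
  fixes f :: "real \<Rightarrow> real"
  shows "(\<lambda>r. f (next_grid h r)) \<in> borel_measurable borel"
proof -
  have 1: "(\<lambda>r. \<lfloor>r / h\<rfloor>) \<in> measurable borel (count_space UNIV)"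
    by measurable
  have 2: "(\<lambda>i. f ((of_int i + 1) * h)) \<in> measurable (count_space (UNIV::int set)) borel"
    by simp
  show ?thesis
    using measurable_compose[OF 1 2] by (simp add: next_grid_def)
qed

lemma right_continuous_next_grid_LIMSEQ:
  fixes Y :: "real \<Rightarrow> real"
  assumes "continuous (at_right r) Y" "\<And>n. 0 < h n" "h \<longlonglongrightarrow> 0"
  shows "(\<lambda>n. Y (next_grid (h n) r)) \<longlonglongrightarrow> Y r"
proof -
  have "(\<lambda>n. next_grid (h n) r) \<longlonglongrightarrow> r"
  proof (rule tendsto_sandwich[of "\<lambda>_. r" _ _ "\<lambda>n. r + h n"])
    show "(\<lambda>n. r + h n) \<longlonglongrightarrow> r"
      using tendsto_add[OF tendsto_const assms(3)] by simp
  qed (use next_grid_bounds assms(2) in \<open>auto intro!: always_eventually less_imp_le\<close>)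
  \<comment> \<open>The strict bound \<open>r < next_grid h r\<close> keeps the sequence inside
    \<open>at_right r\<close>, a filter that excludes r itself.\<close>
  then have "filterlim (\<lambda>n. next_grid (h n) r) (at_right r) sequentially"
    using next_grid_bounds assms(2)
    by (auto simp: filterlim_at intro!: always_eventually) (metis less_irrefl)
  then show ?thesis
    using assms(1) by (auto simp: continuous_within intro: filterlim_compose)
qed

text \<open>A right continuous path is the pointwise limit of its step functions on finer grids. The
  cutoff at 0 is there because paths are unconstrained at negative times.\<close>

lemma right_continuous_measurable:
  fixes Y :: "real \<Rightarrow> real"
  assumes "\<And>t. 0 \<le> t \<Longrightarrow> continuous (at_right t) Y"
  shows "(\<lambda>r. if 0 \<le> r then Y r else 0) \<in> borel_measurable borel"
proof (rule borel_measurable_LIMSEQ_real)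
  fix r :: real
  show "(\<lambda>n. if 0 \<le> r then Y (next_grid (inverse (real (Suc n))) r) else 0)
      \<longlonglongrightarrow> (if 0 \<le> r then Y r else 0)"
    using right_continuous_next_grid_LIMSEQ[OF assms, where h="\<lambda>n. inverse (real (Suc n))"]
    using LIMSEQ_inverse_real_of_nat by auto
next
  fix n
  have [measurable]: "(\<lambda>r. Y (next_grid (inverse (real (Suc n))) r)) \<in> borel_measurable borel"
    by (rule next_grid_measurable)
  show "(\<lambda>r. if 0 \<le> r then Y (next_grid (inverse (real (Suc n))) r) else 0) \<in> borel_measurable borel"
    by measurable
qed

section \<open>Integral estimates on time intervals\<close>

lemma has_integral_abs_bound:
  fixes f g :: "real \<Rightarrow> real"
  assumes "(f has_integral I) {a..b}" "(g has_integral J) {a..b}"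
    and "\<And>r. r \<in> {a..b} \<Longrightarrow> \<bar>f r\<bar> \<le> g r"
  shows "\<bar>I\<bar> \<le> J"
  using integral_norm_bound_integral[of f "{a..b}" g] assms
  by (auto simp: has_integral_iff)

lemma has_integral_increment:
  fixes f :: "real \<Rightarrow> real"
  assumes "\<And>t. 0 \<le> t \<Longrightarrow> (f has_integral F t) {0..t}" "0 \<le> a" "a \<le> b"
  shows "(f has_integral (F b - F a)) {a..b}"
proof -
  have "f integrable_on {a..b}"
    using assms(1)[of b] assms(2,3) by (auto intro: integrable_on_subinterval)
  then have "(f has_integral integral {a..b} f) {a..b}" by (rule integrable_integral)
  moreover have "(f has_integral (F a + integral {a..b} f)) {0..b}"
    using assms by (intro has_integral_combine[of 0 a b] calculation) auto
  then have "F b = F a + integral {a..b} f"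
    using assms(1)[of b] assms(2,3) has_integral_unique by (metis order_trans)
  ultimately show ?thesis by simp
qed

text \<open>Here \<open>w1\<close> is W' and \<open>w2\<close> is W''. One constant \<open>C\<close>
  serves as bound for both and as Lipschitz constant of \<open>w2\<close>; since \<open>w1\<close>
  has derivative \<open>w2\<close>, it is a Lipschitz constant of \<open>w1\<close> as well. The
  relation between \<open>w1\<close> and \<open>w2\<close> is what makes the weighted drift
  divergence free.\<close>

locale bounded_field =
  fixes w1 w2 :: "real \<Rightarrow> real" and C :: real
  assumes C_nonneg: "0 \<le> C"
    and w1_bound: "\<bar>w1 y\<bar> \<le> C" and w2_bound: "\<bar>w2 y\<bar> \<le> C"
    and w1_deriv: "(w1 has_real_derivative w2 y) (at y)"
    and w2_lipschitz: "\<bar>w2 y - w2 y'\<bar> \<le> C * \<bar>y - y'\<bar>"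
    and w1_periodic: "w1 (y + 2 * pi) = w1 y" and w2_periodic: "w2 (y + 2 * pi) = w2 y"
begin

lemma w1_lipschitz: "\<bar>w1 y - w1 y'\<bar> \<le> C * \<bar>y - y'\<bar>"
  using field_differentiable_bound[of UNIV w1 w2 C y y'] w1_deriv w2_bound by auto

lemma continuous_w1: "continuous_on A w1"
  using w1_deriv by (meson DERIV_isCont continuous_at_imp_continuous_on)

lemma continuous_w2: "continuous_on A w2"
proof -
  have "C-lipschitz_on UNIV w2"
    using w2_lipschitz C_nonneg by (intro lipschitz_onI) (auto simp: dist_real_def)
  then show ?thesis
    using lipschitz_on_continuous_on continuous_on_subset by blast
qed

lemma continuous_on_w1 [continuous_intros]:
  "continuous_on A f \<Longrightarrow> continuous_on A (\<lambda>x. w1 (f x))"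
  by (rule continuous_on_compose2[OF continuous_w1[of UNIV]]) auto

lemma continuous_on_w2 [continuous_intros]:
  "continuous_on A f \<Longrightarrow> continuous_on A (\<lambda>x. w2 (f x))"
  by (rule continuous_on_compose2[OF continuous_w2[of UNIV]]) auto

lemma measurable_w1 [measurable]: "w1 \<in> borel_measurable borel"
  using continuous_w1 by (rule borel_measurable_continuous_onI)

lemma measurable_w2 [measurable]: "w2 \<in> borel_measurable borel"
  using continuous_w2 by (rule borel_measurable_continuous_onI)

end

text \<open>A deterministic setting: the path of one realisation from one starting point, with
  probability removed.\<close>

locale solution_path = bounded_field +
  fixes X Y S :: "real \<Rightarrow> real" and y s :: real
  assumes X0: "X 0 = 0"
    and right_continuous: "0 \<le> t \<Longrightarrow> continuous (at_right t) Y"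
    and Y_int: "0 \<le> t \<Longrightarrow> ((\<lambda>r. w1 (Y r) * S r) has_integral (Y t - y - X t)) {0..t}"
    and S_int: "0 \<le> t \<Longrightarrow> ((\<lambda>r. w2 (Y r)) has_integral (S t - s)) {0..t}"
begin

lemma Y_increment:
  assumes "0 \<le> a" "a \<le> b"
  shows "((\<lambda>r. w1 (Y r) * S r) has_integral (Y b - Y a - (X b - X a))) {a..b}"
  using has_integral_increment[OF Y_int assms] by (simp add: algebra_simps)

lemma S_increment:
  assumes "0 \<le> a" "a \<le> b"
  shows "((\<lambda>r. w2 (Y r)) has_integral (S b - S a)) {a..b}"
  using has_integral_increment[OF S_int assms] by simp

text \<open>The noise enters only the equation for Y, so \<open>S\<close> is Lipschitz even when
  \<open>Y\<close> jumps.\<close>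

lemma S_lipschitz:
  assumes "0 \<le> a" "a \<le> b"
  shows "\<bar>S b - S a\<bar> \<le> C * (b - a)"
  using has_integral_abs_bound[OF S_increment[OF assms] has_integral_const_real[of C]] w2_bound assms
  by (simp add: mult.commute)

lemma initial_values: "Y 0 = y" "S 0 = s"
  using Y_int[of 0] S_int[of 0] X0
  by (auto dest!: has_integral_unique[OF has_integral_refl(2)])

lemma S_bound:
  assumes "0 \<le> r" "r \<le> t"
  shows "\<bar>S r\<bar> \<le> \<bar>s\<bar> + C * t"
proof -
  have "C * r \<le> C * t" using assms C_nonneg by (intro mult_left_mono) auto
  then show ?thesis using S_lipschitz[of 0 r] assms initial_values by auto
qed

text \<open>Both the solution and the scheme receive the full noise increment, so it cancels and
  only the drifts are compared. The function \<open>\<delta>\<close> measures how far the fields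
  along \<open>Y\<close> are from their values at the right end of the cell. It may be large before
  a jump, hence only its integral \<open>d\<close> enters. In the constant, R (R + 1) comes from the
  drift of \<open>Y\<close> over the cell and 2 from the motion of \<open>S\<close> and of the
  scheme's second coordinate.\<close>

lemma one_step_error:
  fixes \<delta> :: "real \<Rightarrow> real"
  assumes "0 \<le> a" "0 \<le> h" and R: "\<And>r. r \<in> {a..a+h} \<Longrightarrow> \<bar>S r\<bar> \<le> R"
    and \<delta>: "(\<delta> has_integral d) {a..a+h}"
    and \<delta>_bound: "\<And>r. r \<in> {a..a+h} \<Longrightarrow>
        \<bar>w1 (Y r) - w1 (Y (a+h))\<bar> + \<bar>w2 (Y r) - w2 (Y (a+h))\<bar> \<le> \<delta> r"
    and next_point: "(y', s') = euler_step w1 w2 h (u + (X (a+h) - X a), v)"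
  shows "\<bar>Y (a+h) - y'\<bar> + \<bar>S (a+h) - s'\<bar> \<le>
    (1 + h * (C * (R + 2))) * (\<bar>Y a - u\<bar> + \<bar>S a - v\<bar>) + ((R + 1) * d + h\<^sup>2 * (C\<^sup>2 * (R * (R + 1) + 2)))"
proof -
  define b where "b = a + h"
  \<comment> \<open>The position of the scheme after the noise increment and before the drift acts.
    Up to the initial error it is within O(h) of \<open>Y b\<close>, whatever the jumps in the
    cell.\<close>
  define z where "z = u + (X b - X a)"
  define e where "e = \<bar>Y a - u\<bar> + \<bar>S a - v\<bar>"
  have ab: "a \<le> b" using assms by (simp add: b_def)
  have s': "s' = v + h * w2 z" and y': "y' = z + h * s' * w1 z"
    using next_point by (auto simp: euler_step_def z_def b_def)
  have R0: "0 \<le> R" using R[of a] assms by force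
  have const: "((\<lambda>_. c) has_integral (h * c)) {a..b}" for c :: real
    using has_integral_const_real[of c a b] ab by (simp add: b_def)
  have "\<bar>Y b - Y a - (X b - X a)\<bar> \<le> h * (C * R)"
  proof (rule has_integral_abs_bound[OF Y_increment const])
    fix r assume "r \<in> {a..b}"
    then show "\<bar>w1 (Y r) * S r\<bar> \<le> C * R"
      unfolding abs_mult using R w1_bound C_nonneg by (intro mult_mono) (auto simp: b_def)
  qed (use assms ab in auto)
  then have Yb: "\<bar>Y b - z\<bar> \<le> \<bar>Y a - u\<bar> + h * (C * R)"
    by (auto simp: z_def)
  \<comment> \<open>A common bound for the change of \<open>w1\<close> and of \<open>w2\<close>
    between \<open>Y b\<close> and \<open>z\<close>.\<close>
  define m where "m = C * (\<bar>Y a - u\<bar> + h * (C * R))"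
  have m: "C * \<bar>Y b - z\<bar> \<le> m"
    unfolding m_def using Yb C_nonneg by (intro mult_left_mono)
  have w2e: "\<bar>w2 (Y r) - w2 z\<bar> \<le> \<bar>w2 (Y r) - w2 (Y b)\<bar> + m" for r
    using w2_lipschitz[of "Y b" z] m by linarith
  have w1e: "\<bar>w1 (Y r) - w1 z\<bar> \<le> \<bar>w1 (Y r) - w1 (Y b)\<bar> + m" for r
    using w1_lipschitz[of "Y b" z] m by linarith
  have w12: "\<bar>(S b - S a) - h * w2 z\<bar> + \<bar>(Y b - Y a - (X b - X a)) - h * (s' * w1 z)\<bar>
      \<le> (R + 1) * d + h * ((R + 1) * m + C * (\<bar>S a - v\<bar> + 2 * C * h))"
  proof -
    have pt: "\<bar>w2 (Y r) - w2 z\<bar> + \<bar>w1 (Y r) * S r - s' * w1 z\<bar>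
        \<le> (R + 1) * \<delta> r + ((R + 1) * m + C * (\<bar>S a - v\<bar> + 2 * C * h))" if r: "r \<in> {a..b}" for r
    proof -
      define d1 where "d1 = \<bar>w1 (Y r) - w1 (Y b)\<bar>"
      define d2 where "d2 = \<bar>w2 (Y r) - w2 (Y b)\<bar>"
      have d12: "d1 + d2 \<le> \<delta> r" "0 \<le> d1" "0 \<le> d2"
        using \<delta>_bound[of r] r by (auto simp: d1_def d2_def b_def)
      \<comment> \<open>Splitting the product this way puts the factor \<open>S r\<close>, bounded
        by \<open>R\<close>, on the difference of fields, and the bounded \<open>w1 z\<close> on the
        difference of the second coordinates.\<close>
      have "w1 (Y r) * S r - s' * w1 z = S r * (w1 (Y r) - w1 z) + w1 z * (S r - s')"
        by (simp add: algebra_simps)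
      then have "\<bar>w1 (Y r) * S r - s' * w1 z\<bar> \<le> \<bar>S r\<bar> * \<bar>w1 (Y r) - w1 z\<bar> + \<bar>w1 z\<bar> * \<bar>S r - s'\<bar>"
        by (metis abs_mult abs_triangle_ineq)
      also have "\<dots> \<le> R * (d1 + m) + C * (\<bar>S a - v\<bar> + 2 * C * h)"
      proof (intro add_mono mult_mono)
        have "\<bar>S r - S a\<bar> \<le> C * h"
        proof -
          have "C * (r - a) \<le> C * h" using r C_nonneg by (intro mult_left_mono) (auto simp: b_def)
          then show ?thesis using S_lipschitz[of a r] assms(1) r by auto
        qed
        moreover have "\<bar>h * w2 z\<bar> \<le> C * h"
          using mult_left_mono[OF w2_bound[of z] assms(2)] assms(2) by (simp add: abs_mult mult.commute)
        ultimately show "\<bar>S r - s'\<bar> \<le> \<bar>S a - v\<bar> + 2 * C * h"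
          by (simp add: s')
      qed (use R[of r] r w1e[of r] w1_bound C_nonneg R0 in \<open>auto simp: b_def d1_def\<close>)
      finally have "\<bar>w2 (Y r) - w2 z\<bar> + \<bar>w1 (Y r) * S r - s' * w1 z\<bar>
          \<le> (d2 + m) + (R * (d1 + m) + C * (\<bar>S a - v\<bar> + 2 * C * h))"
        using w2e[of r] by (simp add: d2_def)
      also have "\<dots> = (d2 + R * d1) + ((R + 1) * m + C * (\<bar>S a - v\<bar> + 2 * C * h))"
        by (simp add: algebra_simps)
      also have "d2 + R * d1 \<le> (R + 1) * (d1 + d2)"
        using d12 R0 by (simp add: algebra_simps)
      also have "\<dots> \<le> (R + 1) * \<delta> r"
        using d12 R0 by (intro mult_left_mono) auto
      finally show ?thesis by simp
    qed
    have i2: "((\<lambda>r. w2 (Y r) - w2 z) has_integral ((S b - S a) - h * w2 z)) {a..b}"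
      by (intro has_integral_diff S_increment const assms ab)
    have i1: "((\<lambda>r. w1 (Y r) * S r - s' * w1 z) has_integral
        ((Y b - Y a - (X b - X a)) - h * (s' * w1 z))) {a..b}"
      by (intro has_integral_diff Y_increment const assms ab)
    have ib: "((\<lambda>r. (R + 1) * \<delta> r + ((R + 1) * m + C * (\<bar>S a - v\<bar> + 2 * C * h))) has_integral
       ((R + 1) * d + h * ((R + 1) * m + C * (\<bar>S a - v\<bar> + 2 * C * h)))) {a..b}"
      using \<delta> by (intro has_integral_add has_integral_mult_right const) (simp add: b_def)
    \<comment> \<open>A bound on a sum of two absolute values becomes two bounds on the sum and the
      difference. Both integral errors are thus controlled by one integral of one majorant.\<close>
    have sg: "\<bar>x\<bar> + \<bar>x'\<bar> \<le> c \<longleftrightarrow> \<bar>x + x'\<bar> \<le> c \<and> \<bar>x - x'\<bar> \<le> c" for x x' c :: real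
      by linarith
    show ?thesis
      unfolding sg
      using has_integral_abs_bound[OF has_integral_add[OF i2 i1] ib]
        has_integral_abs_bound[OF has_integral_diff[OF i2 i1] ib] pt[unfolded sg]
      by blast
  qed
  have "\<bar>Y b - y'\<bar> + \<bar>S b - s'\<bar> \<le> e +
     (\<bar>(S b - S a) - h * w2 z\<bar> + \<bar>(Y b - Y a - (X b - X a)) - h * (s' * w1 z)\<bar>)"
    unfolding e_def y' by (simp add: s' z_def algebra_simps)
  also have "\<dots> \<le> e + ((R + 1) * d + h * ((R + 1) * m + C * (\<bar>S a - v\<bar> + 2 * C * h)))"
    using w12 by simp
  also have "h * ((R + 1) * m + C * (\<bar>S a - v\<bar> + 2 * C * h))
      \<le> h * (C * (R + 2) * e + C\<^sup>2 * h * (R * (R + 1) + 2))"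
  proof (rule mult_left_mono[OF _ assms(2)])
    have "(R + 1) * m + C * (\<bar>S a - v\<bar> + 2 * C * h)
       = C * ((R + 1) * \<bar>Y a - u\<bar> + 1 * \<bar>S a - v\<bar>) + C\<^sup>2 * h * (R * (R + 1) + 2)"
      by (simp add: m_def algebra_simps power2_eq_square)
    also have "(R + 1) * \<bar>Y a - u\<bar> + 1 * \<bar>S a - v\<bar> \<le> (R + 2) * e"
      unfolding e_def distrib_left[of "R + 2"] using R0 by (intro add_mono mult_right_mono) auto
    then have "C * ((R + 1) * \<bar>Y a - u\<bar> + 1 * \<bar>S a - v\<bar>) \<le> C * (R + 2) * e"
      using C_nonneg by (simp add: mult_left_mono mult.assoc)
    finally show "(R + 1) * m + C * (\<bar>S a - v\<bar> + 2 * C * h) \<le> C * (R + 2) * e + C\<^sup>2 * h * (R * (R + 1) + 2)"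
      by simp
  qed
  finally show ?thesis
    unfolding b_def e_def by (simp add: algebra_simps power2_eq_square)
qed

end

section \<open>Global error of the scheme along one path\<close>

context solution_path begin

text \<open>Measurability is proved for the path cut off at negative times, which agrees with
  \<open>Y\<close> on the interval of integration; four field values bounded by \<open>C\<close>
  give the majorant.\<close>

lemma grid_defect_integrable:
  assumes "0 < h"
  shows "(\<lambda>r. \<bar>w1 (Y r) - w1 (Y (next_grid h r))\<bar> + \<bar>w2 (Y r) - w2 (Y (next_grid h r))\<bar>) integrable_on {0..t}"
proof -
  have [measurable]: "(\<lambda>r. if 0 \<le> r then Y r else 0) \<in> borel_measurable borel"
    using right_continuous by (rule right_continuous_measurable)
  have [measurable]: "(\<lambda>r. Y (next_grid h r)) \<in> borel_measurable borel"
    by (rule next_grid_measurable)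
  let ?g = "\<lambda>r. \<bar>w1 (if 0 \<le> r then Y r else 0) - w1 (Y (next_grid h r))\<bar> +
    \<bar>w2 (if 0 \<le> r then Y r else 0) - w2 (Y (next_grid h r))\<bar>"
  have "?g integrable_on {0..t}"
  proof (rule measurable_bounded_by_integrable_imp_integrable)
    have "?g \<in> borel_measurable borel" by measurable
    then show "?g \<in> borel_measurable (lebesgue_on {0..t})"
      by (intro measurable_restrict_space1 borel_measurable_if_D measurable_completion) auto
    show "(\<lambda>_. 4 * C) integrable_on {0..t}" by (rule integrable_const_ivl)
  qed (auto intro!: order_trans[OF abs_triangle_ineq4] simp: abs_le_iff,
       (use w1_bound w2_bound in \<open>smt (verit)\<close>)+)
  then show ?thesis
    by (rule integrable_eq) auto
qed

text \<open>Dominated convergence: the integrand tends to 0 at every r by right continuity and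
  continuity of the fields. A cadlag path comes with no modulus of continuity, hence the limit has
  no rate.\<close>

lemma grid_defect_LIMSEQ:
  assumes "\<And>n. 0 < h n" "h \<longlonglongrightarrow> 0"
  shows "(\<lambda>n. integral {0..t} (\<lambda>r. \<bar>w1 (Y r) - w1 (Y (next_grid (h n) r))\<bar> +
     \<bar>w2 (Y r) - w2 (Y (next_grid (h n) r))\<bar>)) \<longlonglongrightarrow> 0"
proof -
  let ?f = "\<lambda>n r. \<bar>w1 (Y r) - w1 (Y (next_grid (h n) r))\<bar> + \<bar>w2 (Y r) - w2 (Y (next_grid (h n) r))\<bar>"
  have "(\<lambda>n. integral {0..t} (?f n)) \<longlonglongrightarrow> integral {0..t} (\<lambda>_. 0)"
  proof (rule dominated_convergence(2))
    show "?f n integrable_on {0..t}" for n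
      by (rule grid_defect_integrable[OF assms(1)])
    show "(\<lambda>_. 4 * C) integrable_on {0..t}" by (rule integrable_const_ivl)
    show "norm (?f n r) \<le> 4 * C" for n r
      using w1_bound[of "Y r"] w2_bound[of "Y r"] w1_bound[of "Y (next_grid (h n) r)"]
        w2_bound[of "Y (next_grid (h n) r)"] unfolding real_norm_def by linarith
    show "(\<lambda>n. ?f n r) \<longlonglongrightarrow> 0" if "r \<in> {0..t}" for r
    proof -
      have Y: "(\<lambda>n. Y (next_grid (h n) r)) \<longlonglongrightarrow> Y r"
        using that assms by (intro right_continuous_next_grid_LIMSEQ right_continuous) auto
      have "isCont w1 (Y r)" "isCont w2 (Y r)"
        using continuous_w1[of UNIV] continuous_w2[of UNIV] by (auto simp: continuous_on_eq_continuous_at)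
      then have "(\<lambda>n. w1 (Y (next_grid (h n) r))) \<longlonglongrightarrow> w1 (Y r)"
          "(\<lambda>n. w2 (Y (next_grid (h n) r))) \<longlonglongrightarrow> w2 (Y r)"
        using Y by (auto intro: isCont_tendsto_compose)
      then have "(\<lambda>n. ?f n r) \<longlonglongrightarrow> \<bar>w1 (Y r) - w1 (Y r)\<bar> + \<bar>w2 (Y r) - w2 (Y r)\<bar>"
        by (intro tendsto_intros)
      then show ?thesis by simp
    qed
  qed
  then show ?thesis by simp
qed

text \<open>The one-step errors accumulate by Gronwall: the cell integrals recombine into
  \<open>D\<close>, and n terms of order h^2 leave T h. \<open>R\<close> bounds |S| on the whole
  interval.\<close>

lemma euler_error:
  fixes n :: nat and h :: real
  assumes h: "0 < h"
  defines "T \<equiv> real n * h"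
  defines "R \<equiv> \<bar>s\<bar> + C * T"
  defines "E \<equiv> euler w1 w2 h (\<lambda>k. X (real k * h)) n (y, s)"
  defines "D \<equiv> integral {0..T} (\<lambda>r. \<bar>w1 (Y r) - w1 (Y (next_grid h r))\<bar> + \<bar>w2 (Y r) - w2 (Y (next_grid h r))\<bar>)"
  shows "\<bar>Y T - fst E\<bar> + \<bar>S T - snd E\<bar> \<le>
     exp (C * (R + 2) * T) * ((R + 1) * D + T * h * (C\<^sup>2 * (R * (R + 1) + 2)))"
proof -
  define \<delta> where "\<delta> r = \<bar>w1 (Y r) - w1 (Y (next_grid h r))\<bar> + \<bar>w2 (Y r) - w2 (Y (next_grid h r))\<bar>" for r
  define x where "x k = X (real k * h)" for k
  define E' where "E' k = euler w1 w2 h x k (y, s)" for k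
  define e where "e k = \<bar>Y (real k * h) - fst (E' k)\<bar> + \<bar>S (real k * h) - snd (E' k)\<bar>" for k
  define d where "d k = integral {real k * h..real (Suc k) * h} \<delta>" for k
  define K where "K = C\<^sup>2 * (R * (R + 1) + 2)"
  have \<delta>_int: "\<delta> integrable_on {a..b}" if "0 \<le> a" for a b
    unfolding \<delta>_def using that
    by (intro integrable_on_subinterval[OF grid_defect_integrable[OF h, of b]]) auto
  have T0: "0 \<le> T" using h by (simp add: T_def)
  then have R0: "0 \<le> R" using C_nonneg by (simp add: R_def)
  have sum_d: "(\<Sum>j<k. d j) = integral {0..real k * h} \<delta>" for k
  proof (induction k)
    case (Suc k)
    then show ?case
      using Henstock_Kurzweil_Integration.integral_combine[of 0 "real k * h" "real (Suc k) * h" \<delta>]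
        \<delta>_int h by (simp add: d_def algebra_simps)
  qed simp
  have d0: "0 \<le> d k" for k
    unfolding d_def using \<delta>_int h by (intro integral_nonneg) (auto simp: \<delta>_def)
  have "e n \<le> exp (h * (C * (R + 2)) * real n) * (\<Sum>j<n. (R + 1) * d j + h\<^sup>2 * K)"
  proof (rule discrete_gronwall[where n=n])
    show "e 0 = 0" by (simp add: e_def E'_def initial_values)
    show "0 \<le> h * (C * (R + 2))" using h C_nonneg R0 by simp
    show "0 \<le> (R + 1) * d k + h\<^sup>2 * K" for k
      using d0 R0 C_nonneg by (simp add: K_def)
    fix k assume k: "k < n"
    have sk: "real (Suc k) * h = real k * h + h" by (simp add: algebra_simps)
    have le_T: "real k * h + h \<le> T"
      unfolding T_def sk[symmetric] using k h by (intro mult_right_mono) auto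
    show "e (Suc k) \<le> (1 + h * (C * (R + 2))) * e k + ((R + 1) * d k + h\<^sup>2 * K)"
      unfolding e_def K_def sk
    proof (rule one_step_error[where \<delta>=\<delta>])
      show "\<bar>S r\<bar> \<le> R" if "r \<in> {real k * h..real k * h + h}" for r
        unfolding R_def using that le_T h
        by (intro S_bound) (auto intro: order_trans[of 0 "real k * h"])
      show "(\<delta> has_integral d k) {real k * h..real k * h + h}"
        unfolding d_def sk using h by (intro integrable_integral \<delta>_int) simp
      show "\<bar>w1 (Y r) - w1 (Y (real k * h + h))\<bar> + \<bar>w2 (Y r) - w2 (Y (real k * h + h))\<bar> \<le> \<delta> r"
        if "r \<in> {real k * h..real k * h + h}" for r
      \<comment> \<open>At the right end of the cell \<open>next_grid\<close> already points one
        cell further, but there the left-hand side is 0.\<close>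
      proof (cases "r = real k * h + h")
        case False
        then have "next_grid h r = real k * h + h"
          using next_grid_eq[OF h, of k r] that sk by simp
        then show ?thesis by (simp add: \<delta>_def)
      qed (simp add: \<delta>_def)
      show "(fst (E' (Suc k)), snd (E' (Suc k))) =
          euler_step w1 w2 h (fst (E' k) + (X (real k * h + h) - X (real k * h)), snd (E' k))"
        by (simp add: E'_def x_def algebra_simps)
    qed (use h in auto)
  qed simp
  also have "(\<Sum>j<n. (R + 1) * d j + h\<^sup>2 * K) = (R + 1) * D + T * h * K"
    using sum_d[of n] by (simp add: sum.distrib flip: sum_distrib_left)
      (simp add: T_def D_def \<delta>_def[abs_def] power2_eq_square)
  finally show ?thesis
    by (simp add: e_def E'_def E_def x_def[abs_def] T_def K_def mult_ac)
qed

text \<open>Taking \<open>Suc n\<close> steps makes the grid end exactly at t and avoids a division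
  by 0.\<close>

lemma euler_LIMSEQ:
  assumes "0 \<le> t"
  defines "h \<equiv> \<lambda>n. t / real (Suc n)"
  shows "(\<lambda>n. euler w1 w2 (h n) (\<lambda>k. X (real k * h n)) (Suc n) (y, s)) \<longlonglongrightarrow> (Y t, S t)"
proof (cases "t = 0")
  case True
  \<comment> \<open>For t = 0 the step length is 0, which the error bound excludes; the scheme then
    never moves.\<close>
  have "euler w1 w2 0 (\<lambda>_. X 0) k (y, s) = (y, s)" for k
    by (induction k) (auto simp: euler_step_def)
  then show ?thesis
    using True by (simp add: h_def initial_values del: euler.simps)
next
  case False
  then have t: "0 < t" using assms by simp
  define R where "R = \<bar>s\<bar> + C * t"
  define D where "D n = integral {0..t} (\<lambda>r. \<bar>w1 (Y r) - w1 (Y (next_grid (h n) r))\<bar> +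
    \<bar>w2 (Y r) - w2 (Y (next_grid (h n) r))\<bar>)" for n
  define E where "E n = euler w1 w2 (h n) (\<lambda>k. X (real k * h n)) (Suc n) (y, s)" for n
  have h: "0 < h n" for n using t by (simp add: h_def)
  have nh: "real (Suc n) * h n = t" for n by (simp add: h_def)
  have h0: "h \<longlonglongrightarrow> 0"
    unfolding h_def using tendsto_mult[OF tendsto_const[of t] LIMSEQ_inverse_real_of_nat]
    by (simp add: divide_inverse)
  have D0: "D \<longlonglongrightarrow> 0"
    unfolding D_def by (rule grid_defect_LIMSEQ[OF h h0])
  define b where "b n = exp (C * (R + 2) * t) * ((R + 1) * D n + t * h n * (C\<^sup>2 * (R * (R + 1) + 2)))" for n
  have "b \<longlonglongrightarrow> exp (C * (R + 2) * t) * ((R + 1) * 0 + t * 0 * (C\<^sup>2 * (R * (R + 1) + 2)))"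
    unfolding b_def by (intro tendsto_intros D0 h0)
  then have b0: "b \<longlonglongrightarrow> 0" by simp
  have err: "\<bar>Y t - fst (E n)\<bar> + \<bar>S t - snd (E n)\<bar> \<le> b n" for n
    using euler_error[OF h, of "Suc n" n] unfolding nh E_def b_def R_def D_def .
  have "(\<lambda>n. fst (E n)) \<longlonglongrightarrow> Y t"
    by (rule LIM_zero_cancel, rule Lim_null_comparison[OF _ b0])
       (use err in \<open>smt (verit) always_eventually real_norm_def\<close>)
  moreover have "(\<lambda>n. snd (E n)) \<longlonglongrightarrow> S t"
    by (rule LIM_zero_cancel, rule Lim_null_comparison[OF _ b0])
       (use err in \<open>smt (verit) always_eventually real_norm_def\<close>)
  ultimately have "(\<lambda>n. (fst (E n), snd (E n))) \<longlonglongrightarrow> (Y t, S t)"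
    by (rule tendsto_Pair)
  then show ?thesis by (simp add: E_def)
qed

end

section \<open>Almost invariance of the Gaussian measure\<close>

text \<open>An antiderivative of \<open>\<phi>\<close> grows by the same amount over every interval
  of length p, so only the end values of \<open>g\<close> count. The map \<open>g\<close> may fold
  back on itself, so the shear in y is covered for every value of h s, with its signed
  Jacobian.\<close>

lemma periodic_substitution:
  fixes \<phi> g g' :: "real \<Rightarrow> real"
  assumes "0 \<le> p" "continuous_on UNIV \<phi>" "\<And>x. \<phi> (x + p) = \<phi> x"
    and g: "\<And>x. (g has_real_derivative g' x) (at x)" "g p = g 0 + p"
  shows "((\<lambda>x. \<phi> (g x) * g' x) has_integral integral {0..p} \<phi>) {0..p}"
proof -
  obtain F where F: "\<And>x. (F has_real_derivative \<phi> x) (at x)"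
    using einterval_antiderivative[of "-\<infinity>" \<infinity> \<phi>] assms(2)
    by (auto simp: continuous_on_eq_continuous_at has_real_derivative_iff_has_vector_derivative)
  have "((\<lambda>x. F (x + p) - F x) has_real_derivative 0) (at x)" for x
    using DERIV_diff[OF DERIV_shift[THEN iffD1, OF F[of "x + p"]] F[of x]] assms(3) by simp
  then have shift: "F (x + p) - F x = F p - F 0" for x
    using DERIV_isconst_all[of "\<lambda>x. F (x + p) - F x" x 0] by simp
  have "((\<lambda>x. \<phi> (g x) * g' x) has_integral (F (g p) - F (g 0))) {0..p}"
  proof (rule fundamental_theorem_of_calculus[OF assms(1)])
    fix x
    show "((\<lambda>x. F (g x)) has_vector_derivative \<phi> (g x) * g' x) (at x within {0..p})"
      using has_field_derivative_at_within[OF DERIV_chain2[OF F g(1)]]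
      by (simp flip: has_real_derivative_iff_has_vector_derivative)
  qed
  moreover have "(\<phi> has_integral (F p - F 0)) {0..p}"
    by (rule fundamental_theorem_of_calculus[OF assms(1)])
       (use has_field_derivative_at_within[OF F] in \<open>simp flip: has_real_derivative_iff_has_vector_derivative\<close>)
  ultimately show ?thesis
    using shift[of "g 0"] g(2) by (simp add: has_integral_iff)
qed

text \<open>Jacobian of the y shear times Gaussian density ratio of the s shear. With p = (r + x) x
  the product equals (1 + p) exp(-p) exp(x^2/2): the first factors lie between 1 - p^2 and 1, the
  last between 1 and 1 + x^2, and |p| is at most |x| (R + 1).\<close>

lemma gaussian_distortion_bound:
  fixes r x R :: real
  assumes "\<bar>r\<bar> \<le> R" and "\<bar>x\<bar> * (R + 1) \<le> 1"
  shows "\<bar>(1 + (r + x) * x) * exp (- r * x - x\<^sup>2 / 2) - 1\<bar> \<le> (R + 1)\<^sup>2 * x\<^sup>2"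
proof -
  define p where "p = (r + x) * x"
  define q where "q = (1 + p) * exp (- p) * exp (x\<^sup>2 / 2)"
  have R: "0 \<le> R" using assms by linarith
  have x1: "\<bar>x\<bar> \<le> 1"
  proof -
    have "\<bar>x\<bar> * 1 \<le> \<bar>x\<bar> * (R + 1)" using R by (intro mult_left_mono) auto
    then show ?thesis using assms(2) by simp
  qed
  have p_le: "\<bar>p\<bar> \<le> \<bar>x\<bar> * (R + 1)"
    unfolding p_def abs_mult using assms(1) x1 by (subst mult.commute, intro mult_left_mono) auto
  then have p1: "\<bar>p\<bar> \<le> 1" using assms(2) by linarith
  have p2: "p\<^sup>2 \<le> (R + 1)\<^sup>2 * x\<^sup>2"
    using power_mono[OF p_le, of 2] by (simp add: power_mult_distrib mult.commute)
  have x2: "x\<^sup>2 \<le> (R + 1)\<^sup>2 * x\<^sup>2"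
    using mult_right_mono[of 1 "(R + 1)\<^sup>2" "x\<^sup>2"] R by (simp add: one_le_power)
  have x21: "x\<^sup>2 \<le> 1" using x1 by (simp add: abs_square_le_1)
  have eq: "(1 + (r + x) * x) * exp (- r * x - x\<^sup>2 / 2) = q"
  proof -
    have "- r * x - x\<^sup>2 / 2 = - p + x\<^sup>2 / 2" by (simp add: p_def power2_eq_square algebra_simps)
    then show ?thesis unfolding q_def p_def[symmetric] by (simp only: exp_add mult.assoc)
  qed
  have "(1 + p) * exp (- p) \<le> exp p * exp (- p)"
    by (intro mult_right_mono exp_ge_add_one_self) auto
  then have up: "(1 + p) * exp (- p) \<le> 1" by (simp add: exp_minus)
  have "(1 + p) * (1 - p) \<le> (1 + p) * exp (- p)"
    using exp_ge_add_one_self[of "-p"] p1 by (intro mult_left_mono) auto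
  then have lo: "1 - p\<^sup>2 \<le> (1 + p) * exp (- p)" by (simp add: algebra_simps power2_eq_square)
  have nn: "0 \<le> (1 + p) * exp (- p)" using p1 by simp
  have "q \<le> 1 * exp (x\<^sup>2 / 2)" unfolding q_def using up by (intro mult_right_mono) auto
  also have "exp (x\<^sup>2 / 2) \<le> 1 + x\<^sup>2"
    using exp_bound_lemma[of "x\<^sup>2 / 2"] x21 by simp
  finally have "q - 1 \<le> x\<^sup>2" by simp
  moreover have "(1 + p) * exp (- p) * 1 \<le> q" unfolding q_def using nn by (intro mult_left_mono) auto
  then have "1 - q \<le> p\<^sup>2" using lo by linarith
  ultimately show ?thesis unfolding eq using p2 x2 by linarith
qed

section \<open>The reference probability law on one period of angles\<close>

abbreviation gauss :: "real measure" where
  "gauss \<equiv> density lborel (\<lambda>x. ennreal (std_normal_density x))"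

definition arc_prob :: "real measure" where
  "arc_prob = density (restrict_space lborel {0..<2 * pi}) (\<lambda>_. ennreal (1 / (2 * pi)))"

definition strip :: "(real \<times> real) measure" where
  "strip = arc_prob \<Otimes>\<^sub>M gauss"

lemma prob_space_gauss: "prob_space gauss"
  using prob_space_normal_density[of 1 0] by simp

lemma prob_space_arc_prob: "prob_space arc_prob"
proof
  have "emeasure arc_prob (space arc_prob) = ennreal (1 / (2 * pi)) * ennreal (2 * pi)"
    by (simp add: arc_prob_def emeasure_restrict_space emeasure_density_const[of "{0..<2 * pi}" "restrict_space lborel {0..<2 * pi}"]
        sets_restrict_space_iff)
  also have "\<dots> = 1"
    by (subst ennreal_mult[symmetric]) auto
  finally show "emeasure arc_prob (space arc_prob) = 1" .
qed

lemma sets_arc_prob [measurable_cong]: "sets arc_prob = sets (restrict_space borel {0..<2 * pi})"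
  by (simp add: arc_prob_def sets_restrict_space)

interpretation strip: pair_prob_space arc_prob gauss
  by (simp add: pair_prob_space_def pair_sigma_finite_def prob_space_arc_prob prob_space_gauss
      prob_space_imp_sigma_finite)

lemma measurable_arc_prob: "f \<in> measurable borel N \<Longrightarrow> f \<in> measurable arc_prob N"
  by (simp add: measurable_cong_sets[OF sets_arc_prob refl] measurable_restrict_space1)

lemma measurable_strip:
  assumes "f \<in> measurable borel N"
  shows "f \<in> measurable strip N"
proof -
  have "(\<lambda>p. (fst p, snd p)) \<in> measurable strip (borel \<Otimes>\<^sub>M borel)"
    unfolding strip_def
    by (intro measurable_Pair measurable_compose[OF measurable_fst measurable_arc_prob]
        measurable_compose[OF measurable_snd]) auto
  then have "(\<lambda>p. p) \<in> measurable strip borel"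
    by (simp add: borel_prod)
  then show ?thesis using assms by (rule measurable_compose)
qed

lemma integral_arc_prob:
  fixes f :: "real \<Rightarrow> real"
  assumes "continuous_on UNIV f"
  shows "(\<integral>y. f y \<partial>arc_prob) = integral {0..2 * pi} f / (2 * pi)"
proof -
  have [measurable]: "f \<in> borel_measurable borel"
    using assms by (rule borel_measurable_continuous_onI)
  have "set_integrable lborel {0..2 * pi} f"
    using continuous_on_subset[OF assms] by (intro borel_integrable_atLeastAtMost') auto
  then have *: "set_integrable lborel {0..<2 * pi} f"
    by (rule set_integrable_subset) auto
  have "(\<integral>y. f y \<partial>arc_prob) = (\<integral>y. (1 / (2 * pi)) *\<^sub>R f y \<partial>restrict_space lborel {0..<2 * pi})"
    unfolding arc_prob_def
    by (rule integral_density) (auto intro!: measurable_restrict_space1)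
  also have "\<dots> = (LBINT y:{0..<2 * pi}. f y) / (2 * pi)"
    by (simp add: integral_restrict_space set_lebesgue_integral_def)
  also have "(LBINT y:{0..<2 * pi}. f y) = integral {0..<2 * pi} f"
    by (rule set_borel_integral_eq_integral(2)[OF *])
  also have "\<dots> = integral {0..2 * pi} f"
    by (rule integral_spike_set) (auto intro: negligible_subset[of "{2 * pi}"])
  finally show ?thesis .
qed

lemma gauss_cameron_martin:
  fixes f :: "real \<Rightarrow> real"
  assumes [measurable]: "f \<in> borel_measurable borel"
  shows "(\<integral>r. f r \<partial>gauss) = (\<integral>r. f (r + x) * exp (- r * x - x\<^sup>2 / 2) \<partial>gauss)"
proof -
  have "(\<integral>r. f r \<partial>gauss) = (\<integral>r. std_normal_density r * f r \<partial>lborel)"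
    by (subst integral_density) (auto simp: normal_density_nonneg)
  also have "\<dots> = (\<integral>r. std_normal_density (r + x) * f (r + x) \<partial>lborel)"
    using lborel_integral_real_affine[of 1 "\<lambda>r. std_normal_density r * f r" x] by (simp add: add.commute)
  also have "\<dots> = (\<integral>r. std_normal_density r * (f (r + x) * exp (- r * x - x\<^sup>2 / 2)) \<partial>lborel)"
  proof (rule Bochner_Integration.integral_cong)
    fix r
    have "std_normal_density (r + x) = std_normal_density r * exp (- r * x - x\<^sup>2 / 2)"
      by (simp add: std_normal_density_def mult_exp_exp power2_eq_square field_simps)
    then show "std_normal_density (r + x) * f (r + x) = std_normal_density r * (f (r + x) * exp (- r * x - x\<^sup>2 / 2))"
      by simp
  qed simp
  also have "\<dots> = (\<integral>r. f (r + x) * exp (- r * x - x\<^sup>2 / 2) \<partial>gauss)"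
    by (subst integral_density) (auto simp: normal_density_nonneg)
  finally show ?thesis .
qed

text \<open>A class of functions that one step of the scheme maps into itself with a larger
  \<open>R\<close>. Periodicity makes the integral over one period invariant under translation;
  vanishing for large |s| confines the distortion to bounded s.\<close>

definition strip_test :: "real \<Rightarrow> real \<Rightarrow> (real \<times> real \<Rightarrow> real) \<Rightarrow> bool" where
  "strip_test B R f \<longleftrightarrow> continuous_on UNIV f \<and> (\<forall>y s. f (y + 2 * pi, s) = f (y, s)) \<and>
     (\<forall>p. \<bar>f p\<bar> \<le> B) \<and> (\<forall>y s. R < \<bar>s\<bar> \<longrightarrow> f (y, s) = 0)"

lemma strip_integrable:
  fixes f :: "real \<times> real \<Rightarrow> real"
  assumes "continuous_on UNIV f" "\<And>p. \<bar>f p\<bar> \<le> B"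
  shows "integrable strip f"
  unfolding strip_def
  using assms measurable_strip[OF borel_measurable_continuous_onI, of f]
  by (intro strip.P.integrable_const_bound[of _ B]) (auto simp: strip_def)

text \<open>The effect of the noise: a translation of the angle leaves the integral unchanged
  exactly, whatever its size.\<close>

lemma strip_integral_shift:
  assumes "strip_test B R f"
  shows "(\<integral>p. f (fst p + c, snd p) \<partial>strip) = (\<integral>p. f p \<partial>strip)"
proof -
  have f: "continuous_on UNIV f" "\<And>y s. f (y + 2 * pi, s) = f (y, s)" "\<And>p. \<bar>f p\<bar> \<le> B"
    using assms by (auto simp: strip_test_def)
  have f': "continuous_on UNIV (\<lambda>p. f (fst p + c, snd p))"
    by (rule continuous_on_compose2[OF f(1)]) (auto intro!: continuous_intros)
  have "(\<integral>y. f (y + c, s) \<partial>arc_prob) = (\<integral>y. f (y, s) \<partial>arc_prob)" for s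
  proof -
    have 1: "continuous_on UNIV (\<lambda>y. f (y, s))"
      by (rule continuous_on_compose2[OF f(1)]) (auto intro!: continuous_intros)
    have 2: "continuous_on UNIV (\<lambda>y. f (y + c, s))"
      by (rule continuous_on_compose2[OF f(1)]) (auto intro!: continuous_intros)
    have "((\<lambda>y. f (y + c, s) * 1) has_integral integral {0..2 * pi} (\<lambda>y. f (y, s))) {0..2 * pi}"
      by (rule periodic_substitution) (auto intro!: derivative_eq_intros simp: 1 f)
    then show ?thesis
      by (simp add: integral_arc_prob 1 2 has_integral_iff)
  qed
  moreover have "(\<integral>p. f (fst p + c, snd p) \<partial>strip) = (\<integral>s. \<integral>y. f (y + c, s) \<partial>arc_prob \<partial>gauss)"
    using strip.integral_snd[of "\<lambda>y s. f (y + c, s)"] strip_integrable[OF f' f(3)]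
    by (simp add: strip_def split_def)
  moreover have "(\<integral>p. f p \<partial>strip) = (\<integral>s. \<integral>y. f (y, s) \<partial>arc_prob \<partial>gauss)"
    using strip.integral_snd[of "\<lambda>y s. f (y, s)"] strip_integrable[OF f(1,3)]
    by (simp add: strip_def split_def)
  ultimately show ?thesis by simp
qed

section \<open>Test functions pulled back along the scheme\<close>

context bounded_field
begin

lemma continuous_euler_step: "continuous_on UNIV (\<lambda>p. euler_step w1 w2 h (fst p + c, snd p))"
  unfolding euler_step_def split_def by (auto intro!: continuous_intros)

lemma strip_test_step:
  assumes "strip_test B R f" "0 \<le> h"
  shows "strip_test B (R + h * C) (\<lambda>p. f (euler_step w1 w2 h (fst p + c, snd p)))"
proof -
  have f: "continuous_on UNIV f" "\<And>y s. f (y + 2 * pi, s) = f (y, s)" "\<And>p. \<bar>f p\<bar> \<le> B"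
    and f0: "\<And>y s. R < \<bar>s\<bar> \<Longrightarrow> f (y, s) = 0"
    using assms by (auto simp: strip_test_def)
  have "continuous_on UNIV (\<lambda>p. f (euler_step w1 w2 h (fst p + c, snd p)))"
    by (rule continuous_on_compose2[OF f(1) continuous_euler_step]) auto
  moreover have "f (euler_step w1 w2 h (y + 2 * pi + c, s)) = f (euler_step w1 w2 h (y + c, s))" for y s
  proof -
    define z where "z = y + c"
    have z: "y + 2 * pi + c = z + 2 * pi" by (simp add: z_def)
    have "euler_step w1 w2 h (z + 2 * pi, s) =
        (fst (euler_step w1 w2 h (z, s)) + 2 * pi, snd (euler_step w1 w2 h (z, s)))"
      by (simp add: euler_step_def w1_periodic w2_periodic)
    then show ?thesis unfolding z z_def[symmetric] by (simp add: f(2))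
  qed
  moreover have "f (euler_step w1 w2 h (y + c, s)) = 0" if "R + h * C < \<bar>s\<bar>" for y s
  proof -
    have "h * \<bar>w2 (y + c)\<bar> \<le> h * C"
      using w2_bound assms(2) by (intro mult_left_mono)
    then have "R < \<bar>s + h * w2 (y + c)\<bar>"
      using that assms(2) abs_mult[of h "w2 (y + c)"] by linarith
    then show ?thesis by (simp add: euler_step_def f0)
  qed
  ultimately show ?thesis using f(3) by (simp add: strip_test_def)
qed

text \<open>Undoing the y shear at fixed s and then the s shear at fixed y turns the integral of
  \<open>f\<close> into that of \<open>fs\<close> times the distortion \<open>q\<close>; the
  distance of \<open>q\<close> from 1 is of second order where \<open>fs\<close> can be
  nonzero.\<close>

lemma step_almost_invariant:
  assumes f: "strip_test B R f" and h: "0 \<le> h" "h * C * (R + h * C + 1) \<le> 1" and R: "0 \<le> R"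
  shows "\<bar>(\<integral>p. f (euler_step w1 w2 h p) \<partial>strip) - (\<integral>p. f p \<partial>strip)\<bar> \<le> B * ((R + h * C + 1)\<^sup>2 * (h * C)\<^sup>2)"
proof -
  have cont: "continuous_on UNIV f" and per: "\<And>y s. f (y + 2 * pi, s) = f (y, s)"
    and fB: "\<And>p. \<bar>f p\<bar> \<le> B" and f0: "\<And>y s. R < \<bar>s\<bar> \<Longrightarrow> f (y, s) = 0"
    using f by (auto simp: strip_test_def)
  have B: "0 \<le> B" using fB[of "(0, 0)"] by linarith
  define fs where "fs p = f (euler_step w1 w2 h p)" for p
  have fs: "strip_test B (R + h * C) fs"
    using strip_test_step[OF f h(1), of 0] by (simp add: fs_def[abs_def])
  then have fs_cont: "continuous_on UNIV fs" and fsB: "\<And>p. \<bar>fs p\<bar> \<le> B"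
    and fs0: "\<And>y s. R + h * C < \<bar>s\<bar> \<Longrightarrow> fs (y, s) = 0"
    by (auto simp: strip_test_def)
  \<comment> \<open>\<open>f\<close> after the y shear, times the Jacobian of that shear.\<close>
  define g where "g = (\<lambda>(y, s). f (y + h * s * w1 y, s) * (1 + h * s * w2 y))"
  \<comment> \<open>The Jacobian taken at the shifted value s + h w2 y, times the Cameron-Martin
    density for the shift h w2 y.\<close>
  define q where "q = (\<lambda>(y, s). (1 + (s + h * w2 y) * (h * w2 y)) * exp (- s * (h * w2 y) - (h * w2 y)\<^sup>2 / 2))"
  have g_cont: "continuous_on UNIV g"
    unfolding g_def split_def
    by (intro continuous_intros continuous_on_compose2[OF cont]) (auto intro!: continuous_intros)
  have gB: "\<bar>g p\<bar> \<le> B * (1 + h * R * C)" for p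
  proof (cases p)
    case (Pair y s)
    show ?thesis
    proof (cases "R < \<bar>s\<bar>")
      case True
      then show ?thesis using Pair f0 B h R C_nonneg by (simp add: g_def)
    next
      case False
      have "\<bar>h * s * w2 y\<bar> \<le> h * R * C"
        unfolding abs_mult using False h R w2_bound by (intro mult_mono) auto
      then have "\<bar>1 + h * s * w2 y\<bar> \<le> 1 + h * R * C" by linarith
      then show ?thesis
        unfolding g_def Pair prod.case abs_mult using fB B by (intro mult_mono) auto
    qed
  qed
  have q_cont: "continuous_on UNIV q"
    unfolding q_def split_def by (auto intro!: continuous_intros)
  have small: "\<bar>fs p * (q p - 1)\<bar> \<le> B * ((R + h * C + 1)\<^sup>2 * (h * C)\<^sup>2)" for p
  proof (cases p)
    case (Pair y s)
    show ?thesis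
    proof (cases "R + h * C < \<bar>s\<bar>")
      case True
      then show ?thesis using Pair fs0 B by simp
    next
      case False
      have x: "\<bar>h * w2 y\<bar> \<le> h * C"
        unfolding abs_mult using w2_bound h by (simp add: mult_left_mono)
      then have "\<bar>h * w2 y\<bar> * (R + h * C + 1) \<le> h * C * (R + h * C + 1)"
        using R h C_nonneg by (intro mult_right_mono) auto
      then have "\<bar>q p - 1\<bar> \<le> (R + h * C + 1)\<^sup>2 * (h * w2 y)\<^sup>2"
        unfolding q_def Pair prod.case
        using False h by (intro gaussian_distortion_bound) auto
      also have "\<dots> \<le> (R + h * C + 1)\<^sup>2 * (h * C)\<^sup>2"
        using power_mono[OF x, of 2] by (intro mult_left_mono) auto
      finally show ?thesis
        unfolding abs_mult using fsB B by (intro mult_mono) auto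
    qed
  qed
  have int_fs: "integrable strip fs" by (rule strip_integrable[OF fs_cont fsB])
  have int_d: "integrable strip (\<lambda>p. fs p * (q p - 1))"
    by (rule strip_integrable[OF _ small]) (intro continuous_intros fs_cont q_cont)
  have int_fq: "integrable strip (\<lambda>p. fs p * q p)"
    using Bochner_Integration.integrable_add[OF int_d int_fs] by (simp add: algebra_simps)
  have "(\<integral>p. f p \<partial>strip) = (\<integral>s. \<integral>y. f (y, s) \<partial>arc_prob \<partial>gauss)"
    using strip.integral_snd[of "\<lambda>y s. f (y, s)"] strip_integrable[OF cont fB]
    by (simp add: strip_def split_def)
  also have "\<dots> = (\<integral>s. \<integral>y. g (y, s) \<partial>arc_prob \<partial>gauss)"
  proof (rule Bochner_Integration.integral_cong[OF refl])
    fix s :: real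
    have 1: "continuous_on UNIV (\<lambda>y. f (y, s))"
      by (rule continuous_on_compose2[OF cont]) (auto intro!: continuous_intros)
    have 2: "continuous_on UNIV (\<lambda>y. g (y, s))"
      by (rule continuous_on_compose2[OF g_cont]) (auto intro!: continuous_intros)
    have "((\<lambda>y. f (y + h * s * w1 y, s) * (1 + h * s * w2 y)) has_integral
        integral {0..2 * pi} (\<lambda>y. f (y, s))) {0..2 * pi}"
    proof (rule periodic_substitution)
      show "((\<lambda>y. y + h * s * w1 y) has_real_derivative 1 + h * s * w2 y) (at y)" for y
        using w1_deriv[of y] by (auto intro!: derivative_eq_intros)
      show "2 * pi + h * s * w1 (2 * pi) = 0 + h * s * w1 0 + 2 * pi"
        using w1_periodic[of 0] by simp
    qed (auto simp: 1 per)
    then show "(\<integral>y. f (y, s) \<partial>arc_prob) = (\<integral>y. g (y, s) \<partial>arc_prob)"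
      by (simp add: integral_arc_prob 1 2 has_integral_iff) (simp add: g_def)
  qed
  \<comment> \<open>The order of integration changes because the shift of s depends on y: it is a
    constant only once y is fixed.\<close>
  also have "\<dots> = (\<integral>y. \<integral>s. g (y, s) \<partial>gauss \<partial>arc_prob)"
    using strip.Fubini_integral[of "\<lambda>y s. g (y, s)"] strip_integrable[OF g_cont gB]
    by (simp add: strip_def split_def)
  also have "\<dots> = (\<integral>y. \<integral>s. fs (y, s) * q (y, s) \<partial>gauss \<partial>arc_prob)"
  proof (rule Bochner_Integration.integral_cong[OF refl])
    fix y :: real
    have "continuous_on UNIV (\<lambda>s. g (y, s))"
      by (rule continuous_on_compose2[OF g_cont]) (auto intro!: continuous_intros)
    then have "(\<lambda>s. g (y, s)) \<in> borel_measurable borel"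
      by (rule borel_measurable_continuous_onI)
    from gauss_cameron_martin[OF this, of "h * w2 y"]
    show "(\<integral>s. g (y, s) \<partial>gauss) = (\<integral>s. fs (y, s) * q (y, s) \<partial>gauss)"
      by (simp add: g_def fs_def q_def euler_step_def mult_ac)
  qed
  also have "\<dots> = (\<integral>p. fs p * q p \<partial>strip)"
    using strip.integral_fst'[of "\<lambda>p. fs p * q p"] int_fq
    by (simp add: strip_def)
  finally have "(\<integral>p. f p \<partial>strip) - (\<integral>p. fs p \<partial>strip) = (\<integral>p. fs p * (q p - 1) \<partial>strip)"
    using int_fs int_fq by (simp add: right_diff_distrib)
  moreover have "\<bar>\<integral>p. fs p * (q p - 1) \<partial>strip\<bar> \<le> (\<integral>p. B * ((R + h * C + 1)\<^sup>2 * (h * C)\<^sup>2) \<partial>strip)"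
    using integral_abs_bound[of strip "\<lambda>p. fs p * (q p - 1)"]
    by (rule order_trans) (intro integral_mono integrable_abs int_d small strip_integrable[OF continuous_on_const order_refl])
  moreover have "(\<integral>p. B * ((R + h * C + 1)\<^sup>2 * (h * C)\<^sup>2) \<partial>strip) = B * ((R + h * C + 1)\<^sup>2 * (h * C)\<^sup>2)"
    by (simp add: strip_def strip.P.prob_space)
  ultimately show ?thesis
    unfolding fs_def by linarith
qed

text \<open>The induction peels off the last step and absorbs it into the test function, so
  \<open>f\<close> and \<open>R\<close> vary, while \<open>R'\<close> bounds all radii that occur.
  The noise values \<open>x\<close> do not enter the bound, which is therefore uniform in the
  realisation.\<close>

lemma euler_almost_invariant:
  assumes "strip_test B R f" "0 \<le> h" "0 \<le> R" "R + real n * h * C \<le> R'" "h * C * (R' + 1) \<le> 1"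
  shows "\<bar>(\<integral>p. f (euler w1 w2 h x n p) \<partial>strip) - (\<integral>p. f p \<partial>strip)\<bar> \<le> real n * (B * ((R' + 1)\<^sup>2 * (h * C)\<^sup>2))"
  using assms
proof (induction n arbitrary: f R)
  case 0
  then show ?case by simp
next
  case (Suc n)
  have hC: "0 \<le> h * C" using Suc.prems C_nonneg by simp
  define c where "c = x (Suc n) - x n"
  have B: "0 \<le> B" using Suc.prems(1) by (auto simp: strip_test_def) (meson abs_ge_zero order_trans)
  have "R + h * C \<le> R'"
    using Suc.prems(4) mult_nonneg_nonneg[OF of_nat_0_le_iff hC, of n] by (simp add: algebra_simps)
  then have R1: "R + h * C + 1 \<le> R' + 1" by simp
  let ?f = "\<lambda>p. f (euler_step w1 w2 h (fst p + c, snd p))"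
  have "\<bar>(\<integral>p. ?f (euler w1 w2 h x n p) \<partial>strip) - (\<integral>p. ?f p \<partial>strip)\<bar> \<le> real n * (B * ((R' + 1)\<^sup>2 * (h * C)\<^sup>2))"
    using Suc.prems hC by (intro Suc.IH[of "R + h * C"] strip_test_step[of B R]) (auto simp: algebra_simps)
  moreover have "(\<integral>p. ?f p \<partial>strip) = (\<integral>p. f (euler_step w1 w2 h p) \<partial>strip)"
    using strip_integral_shift[OF strip_test_step[OF Suc.prems(1,2), of 0], of c] by simp
  moreover have "\<bar>(\<integral>p. f (euler_step w1 w2 h p) \<partial>strip) - (\<integral>p. f p \<partial>strip)\<bar> \<le> B * ((R + h * C + 1)\<^sup>2 * (h * C)\<^sup>2)"
    using Suc.prems mult_left_mono[OF R1 hC]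
    by (intro step_almost_invariant) auto
  moreover have "B * ((R + h * C + 1)\<^sup>2 * (h * C)\<^sup>2) \<le> B * ((R' + 1)\<^sup>2 * (h * C)\<^sup>2)"
    using R1 Suc.prems hC B by (intro mult_left_mono mult_right_mono power_mono) auto
  ultimately show ?case
    by (simp add: c_def algebra_simps)
qed

end

section \<open>Measures on the cylinder\<close>

text \<open>Open boxes form a generator stable under intersection. The indicator of a box is the
  limit of truncated multiples of the distance to its complement, which are continuous and vanish
  outside the bounded box.\<close>

lemma borel_measure_eqI_continuous:
  fixes \<mu> \<nu> :: "'a::euclidean_space measure"
  assumes "finite_measure \<mu>" "finite_measure \<nu>" and sets_eq: "sets \<mu> = sets borel" "sets \<nu> = sets borel"
    and eq: "\<And>g :: 'a \<Rightarrow> real. continuous_on UNIV g \<Longrightarrow> (\<And>x. 0 \<le> g x \<and> g x \<le> 1) \<Longrightarrow>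
      bounded {x. g x \<noteq> 0} \<Longrightarrow> (\<integral>x. g x \<partial>\<mu>) = (\<integral>x. g x \<partial>\<nu>)"
  shows "\<mu> = \<nu>"
proof (rule measure_eqI_generator_eq)
  interpret \<mu>: finite_measure \<mu> by fact
  interpret \<nu>: finite_measure \<nu> by fact
  let ?E = "range (\<lambda>(a, b). box a b :: 'a set)"
  show "Int_stable ?E"
    by (auto simp: Int_stable_def box_Int_box)
  show "?E \<subseteq> Pow UNIV" by simp
  have "sets (borel :: 'a measure) = sigma_sets UNIV ?E"
    by (subst borel_eq_box) simp
  then show "sets \<mu> = sigma_sets UNIV ?E" "sets \<nu> = sigma_sets UNIV ?E"
    by (simp_all add: sets_eq)
  show "range (\<lambda>i::nat. box (- (real i *\<^sub>R One)) (real i *\<^sub>R One)) \<subseteq> ?E" by auto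
  show "(\<Union>i::nat. box (- (real i *\<^sub>R One)) (real i *\<^sub>R One)) = (UNIV :: 'a set)"
    by (rule UN_box_eq_UNIV)
  show "emeasure \<mu> (box (- (real i *\<^sub>R One)) (real i *\<^sub>R One)) \<noteq> \<infinity>" for i
    by simp
  fix U assume "U \<in> ?E"
  then have U: "open U" "bounded U" by auto
  then have U_sets: "U \<in> sets \<mu>" "U \<in> sets \<nu>" by (auto simp: sets_eq)
  \<comment> \<open>The distance to an empty set is 0 by convention, so the complement must contain
    a point.\<close>
  have ne: "- U \<noteq> {}" using U(2) not_bounded_UNIV by (metis Compl_empty_eq double_compl)
  define g where "g n x = min 1 (real n * infdist x (- U))" for n x
  have g_cont: "continuous_on UNIV (g n)" for n
    unfolding g_def by (intro continuous_intros)
  have g_range: "0 \<le> g n x \<and> g n x \<le> 1" for n x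
    by (simp add: g_def infdist_nonneg)
  have g_outside: "g n x = 0" if "x \<notin> U" for n x
    using that by (simp add: g_def)
  have g_bdd: "bounded {x. g n x \<noteq> 0}" for n
    by (rule bounded_subset[OF U(2)]) (use g_outside in auto)
  have lim: "(\<lambda>n. g n x) \<longlonglongrightarrow> indicator U x" for x
  proof (cases "x \<in> U")
    case True
    then have pos: "0 < infdist x (- U)"
      using U(1) ne by (intro infdist_pos_not_in_closed) auto
    obtain N where "1 < real N * infdist x (- U)"
      using reals_Archimedean3[OF pos] by blast
    then have "g n x = 1" if "N \<le> n" for n
    proof -
      have "real N * infdist x (- U) \<le> real n * infdist x (- U)"
        using that infdist_nonneg by (intro mult_right_mono) auto
      then show ?thesis
        using \<open>1 < real N * infdist x (- U)\<close> by (simp add: g_def)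
    qed
    then show ?thesis
      using True by (intro tendsto_eventually eventually_sequentiallyI[of N]) simp
  qed (simp add: g_outside)
  have "(\<lambda>n. \<integral>x. g n x \<partial>M) \<longlonglongrightarrow> measure M U" if "finite_measure M" "sets M = sets borel" for M
  proof -
    interpret finite_measure M by fact
    have [measurable]: "U \<in> sets M" using U that by simp
    have [measurable]: "g n \<in> borel_measurable M" for n
      using borel_measurable_continuous_onI[OF g_cont] that(2) by (simp cong: measurable_cong_sets)
    have "(\<lambda>n. \<integral>x. g n x \<partial>M) \<longlonglongrightarrow> (\<integral>x. indicator U x \<partial>M)"
      by (rule integral_dominated_convergence[where w="\<lambda>_. 1"]) (use lim g_range in auto)
    then show ?thesis using sets_eq_imp_space_eq[OF that(2)] by simp
  qed
  from this[of \<mu>] this[of \<nu>] have "measure \<mu> U = measure \<nu> U"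
    using assms(1,2) sets_eq eq[OF g_cont g_range g_bdd] LIMSEQ_unique by simp
  then show "emeasure \<mu> U = emeasure \<nu> U"
    by (simp add: \<mu>.emeasure_eq_measure \<nu>.emeasure_eq_measure)
qed

section \<open>Passage between plane and cylinder\<close>

definition to_cylinder :: "real \<times> real \<Rightarrow> complex \<times> real" where
  "to_cylinder p = (cis (fst p), snd p)"

text \<open>A section of \<open>to_cylinder\<close>, using the same branch \<open>Arg\<close> as
  \<open>cylinder_transition\<close>.\<close>

definition from_cylinder :: "complex \<times> real \<Rightarrow> real \<times> real" where
  "from_cylinder u = (Arg (fst u), snd u)"

lemma continuous_to_cylinder: "continuous_on A to_cylinder"
  unfolding to_cylinder_def by (intro continuous_intros)

lemma measurable_cis: "cis \<in> measurable borel circle_borel"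
  unfolding circle_borel_def
  by (intro measurable_restrict_space2 borel_measurable_continuous_onI continuous_intros) auto

lemma measurable_to_cylinder [measurable]: "to_cylinder \<in> measurable borel cylinder_borel"
proof -
  have "to_cylinder \<in> measurable (borel \<Otimes>\<^sub>M borel) cylinder_borel"
    unfolding to_cylinder_def cylinder_borel_def
    by (intro measurable_Pair measurable_compose[OF measurable_fst measurable_cis] measurable_snd)
  then show ?thesis by (simp add: borel_prod)
qed

text \<open>\<open>Arg\<close> is continuous off the closed negative real axis, equals pi on it away
  from 0, and is 0 at 0; so it is a sum of two functions continuous on Borel pieces.\<close>

lemma measurable_Arg: "Arg \<in> borel_measurable borel"
proof -
  have "(\<lambda>z. indicator (- \<real>\<^sub>\<le>\<^sub>0) z *\<^sub>R Arg z + indicator (\<real>\<^sub>\<le>\<^sub>0 - {0}) z *\<^sub>R pi) \<in> borel_measurable borel"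
    by (intro borel_measurable_add borel_measurable_continuous_on_indicator continuous_on_Arg
        continuous_on_const sets.Diff) auto
  moreover have "indicator (- \<real>\<^sub>\<le>\<^sub>0) z *\<^sub>R Arg z + indicator (\<real>\<^sub>\<le>\<^sub>0 - {0}) z *\<^sub>R pi = Arg z" for z
  proof (cases "z = 0")
    case False
    then show ?thesis
      using Arg_eq_pi[of z] by (auto simp: complex_nonpos_Reals_iff indicator_def complex_eq_iff)
  qed (simp add: Arg_zero)
  ultimately show ?thesis by simp
qed

lemma measurable_from_cylinder [measurable]: "from_cylinder \<in> measurable cylinder_borel borel"
proof -
  have "Arg \<in> borel_measurable circle_borel"
    unfolding circle_borel_def using measurable_Arg by (rule measurable_restrict_space1)
  then have "from_cylinder \<in> measurable cylinder_borel (borel \<Otimes>\<^sub>M borel)"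
    unfolding from_cylinder_def cylinder_borel_def
    by (intro measurable_Pair measurable_compose[OF measurable_fst] measurable_snd)
  then show ?thesis by (simp add: borel_prod)
qed

lemma space_cylinder_borel: "space cylinder_borel = sphere 0 1 \<times> UNIV"
  by (simp add: cylinder_borel_def circle_borel_def space_pair_measure space_restrict_space)

lemma sets_cylinder_borel_subset: "sets cylinder_borel \<subseteq> sets borel"
proof -
  have sphere: "sphere 0 1 \<in> sets (borel :: complex measure)"
    by (intro borel_closed closed_sphere)
  have "a \<times> b \<in> sets (borel \<Otimes>\<^sub>M borel)" if "a \<in> sets circle_borel" "b \<in> sets borel"
    for a :: "complex set" and b :: "real set"
    using that sphere by (auto simp: circle_borel_def sets_restrict_space_iff)
  moreover have "sphere 0 1 \<times> UNIV \<in> sets (borel \<Otimes>\<^sub>M borel :: (complex \<times> real) measure)"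
    using sphere by auto
  ultimately have "sets cylinder_borel \<subseteq> sets (borel \<Otimes>\<^sub>M borel)"
    unfolding cylinder_borel_def sets_pair_measure
    by (intro sets.sigma_sets_subset'[of _ "borel \<Otimes>\<^sub>M borel", unfolded sets_pair_measure])
      (auto simp: circle_borel_def space_restrict_space sets_pair_measure)
  then show ?thesis by (simp only: borel_prod)
qed

lemma measurable_cylinder_borel_ident: "(\<lambda>u. u) \<in> measurable cylinder_borel borel"
proof -
  have "(\<lambda>u. (fst u, snd u)) \<in> measurable cylinder_borel (borel \<Otimes>\<^sub>M borel)"
    unfolding cylinder_borel_def circle_borel_def
    by (intro measurable_Pair measurable_compose[OF measurable_fst] measurable_snd measurable_restrict_space1)
      auto
  then show ?thesis by (simp add: borel_prod)
qed

text \<open>Both measures are pushed forward to the ambient Euclidean space, where continuous test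
  functions decide. Nothing is lost, as the circle is closed and Borel sets of the cylinder are
  Borel in that space.\<close>

lemma cylinder_measure_eqI:
  assumes "finite_measure \<mu>" "finite_measure \<nu>"
    and sets_eq: "sets \<mu> = sets cylinder_borel" "sets \<nu> = sets cylinder_borel"
    and eq: "\<And>g :: complex \<times> real \<Rightarrow> real. continuous_on UNIV g \<Longrightarrow> (\<And>u. 0 \<le> g u \<and> g u \<le> 1) \<Longrightarrow>
      bounded {u. g u \<noteq> 0} \<Longrightarrow> (\<integral>u. g u \<partial>\<mu>) = (\<integral>u. g u \<partial>\<nu>)"
  shows "\<mu> = \<nu>"
proof (rule measure_eqI)
  have id: "(\<lambda>u. u) \<in> measurable \<mu> borel" "(\<lambda>u. u) \<in> measurable \<nu> borel"
    using measurable_cylinder_borel_ident sets_eq by (simp_all cong: measurable_cong_sets)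
  have distr_eq: "distr \<mu> borel (\<lambda>u. u) = distr \<nu> borel (\<lambda>u. u)"
  proof (rule borel_measure_eqI_continuous)
    fix g :: "complex \<times> real \<Rightarrow> real"
    assume g: "continuous_on UNIV g" "\<And>u. 0 \<le> g u \<and> g u \<le> 1" "bounded {u. g u \<noteq> 0}"
    have "g \<in> borel_measurable borel" using g(1) by (rule borel_measurable_continuous_onI)
    then show "(\<integral>u. g u \<partial>distr \<mu> borel (\<lambda>u. u)) = (\<integral>u. g u \<partial>distr \<nu> borel (\<lambda>u. u))"
      using eq[OF g] by (simp add: integral_distr id)
  qed (auto intro!: finite_measure.finite_measure_distr assms id)
  fix B assume B: "B \<in> sets \<mu>"
  then have "B \<in> sets borel" using sets_cylinder_borel_subset sets_eq by auto
  moreover have "B \<inter> space \<mu> = B" "B \<inter> space \<nu> = B"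
    using sets.sets_into_space[OF B] sets_eq_imp_space_eq[of \<mu> \<nu>] sets_eq by auto
  ultimately show "emeasure \<mu> B = emeasure \<nu> B"
    using arg_cong[OF distr_eq, of "\<lambda>m. emeasure m B"] by (simp add: emeasure_distr id)
qed (simp add: sets_eq)

lemma cylinder_gauss_eq: "cylinder_gauss = distr strip cylinder_borel to_cylinder"
proof -
  define U where "U = restrict_space lborel {0..<2 * pi}"
  define c where "c = (\<lambda>p::real \<times> real. ennreal (1 / (2 * pi)) * ennreal (std_normal_density (snd p)))"
  define \<rho> where "\<rho> = (\<lambda>(z::complex, s). ennreal (1 / (2 * pi) powr (3 / 2) * exp (- s\<^sup>2 / 2)))"
  have cis: "cis \<in> measurable U circle_borel"
    unfolding U_def using measurable_cis by (intro measurable_restrict_space1) simp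
  have cyl: "to_cylinder \<in> measurable (U \<Otimes>\<^sub>M lborel) (circle_borel \<Otimes>\<^sub>M lborel)"
    unfolding to_cylinder_def
    by (intro measurable_Pair measurable_compose[OF measurable_fst cis] measurable_snd)
  have "arc_length \<Otimes>\<^sub>M lborel = distr U circle_borel cis \<Otimes>\<^sub>M distr lborel lborel (\<lambda>s::real. s)"
    by (simp add: arc_length_def U_def distr_id2)
  also have "\<dots> = distr (U \<Otimes>\<^sub>M lborel) (circle_borel \<Otimes>\<^sub>M lborel) (\<lambda>(y, s). (cis y, s))"
    by (rule pair_measure_distr[OF cis]) (auto simp: distr_id2 lborel.sigma_finite_measure_axioms)
  also have "(\<lambda>(y, s). (cis y, s)) = to_cylinder"
    by (auto simp: to_cylinder_def)
  finally have "cylinder_gauss = density (distr (U \<Otimes>\<^sub>M lborel) (circle_borel \<Otimes>\<^sub>M lborel) to_cylinder) \<rho>"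
    by (simp add: cylinder_gauss_def \<rho>_def)
  also have "\<dots> = distr (density (U \<Otimes>\<^sub>M lborel) (\<lambda>p. \<rho> (to_cylinder p))) (circle_borel \<Otimes>\<^sub>M lborel) to_cylinder"
    by (rule density_distr[OF _ cyl]) (simp add: \<rho>_def)
  also have "(\<lambda>p. \<rho> (to_cylinder p)) = c"
  proof
    fix p :: "real \<times> real"
    \<comment> \<open>The constant splits into 1 / (2 pi) for the uniform angle and 1 / sqrt (2 pi)
      for the normal density.\<close>
    have "(2 * pi) powr (3 / 2) = (2 * pi) powr (1 + 1 / 2)" by simp
    also have "\<dots> = (2 * pi) * sqrt (2 * pi)"
      by (subst powr_add) (simp add: powr_half_sqrt)
    finally show "\<rho> (to_cylinder p) = c p"
      by (simp add: \<rho>_def to_cylinder_def c_def std_normal_density_def flip: ennreal_mult)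
  qed
  also have "density (U \<Otimes>\<^sub>M lborel) c = strip"
    unfolding strip_def arc_prob_def U_def[symmetric] c_def
    by (subst pair_measure_density)
      (auto simp: split_def lborel.sigma_finite_measure_axioms prob_space_gauss prob_space_imp_sigma_finite)
  also have "distr strip (circle_borel \<Otimes>\<^sub>M lborel) to_cylinder = distr strip cylinder_borel to_cylinder"
    by (rule distr_cong) (auto simp: cylinder_borel_def intro!: sets_pair_measure_cong)
  finally show ?thesis .
qed

lemma prob_space_strip: "prob_space strip"
  unfolding strip_def by (rule strip.prob_space_axioms)

lemma measurable_strip_to_cylinder: "to_cylinder \<in> measurable strip cylinder_borel"
  using measurable_to_cylinder by (rule measurable_strip)

lemma prob_space_cylinder_gauss: "prob_space cylinder_gauss"
  unfolding cylinder_gauss_eq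
  by (rule prob_space.prob_space_distr[OF prob_space_strip measurable_strip_to_cylinder])

lemma sets_cylinder_gauss: "sets cylinder_gauss = sets cylinder_borel"
  by (simp add: cylinder_gauss_eq)

section \<open>Periodic potentials yield bounded fields\<close>

lemma periodic_cis_cong:
  assumes "\<And>x. f (x + 2 * pi) = f x" "cis a = cis b"
  shows "f a = f b"
proof -
  interpret periodic_fun_simple f "2 * pi" by standard (rule assms(1))
  have "sin a = sin b \<and> cos a = cos b" using assms(2) by (simp add: complex_eq_iff)
  then obtain n :: int where "a = b + 2 * pi * n"
    unfolding sin_cos_eq_iff by blast
  then show ?thesis using plus_of_int[of b n] by (simp add: mult_ac)
qed

lemma cis_Arg_cis: "cis (Arg (cis y)) = cis y"
  by (simp add: cis_Arg sgn_div_norm)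

lemma periodic_bounded:
  fixes f :: "real \<Rightarrow> real"
  assumes "continuous_on UNIV f" "\<And>x. f (x + 2 * pi) = f x"
  obtains B where "\<And>x. \<bar>f x\<bar> \<le> B"
proof -
  have "bounded (f ` {- pi..pi})"
    using assms(1) by (intro compact_imp_bounded compact_continuous_image) (auto intro: continuous_on_subset)
  then obtain B where "\<forall>z\<in>f ` {- pi..pi}. \<bar>z\<bar> \<le> B"
    by (auto simp: bounded_iff)
  then have B: "\<And>x. x \<in> {- pi..pi} \<Longrightarrow> \<bar>f x\<bar> \<le> B" by blast
  have "\<bar>f x\<bar> \<le> B" for x
    using B[of "Arg (cis x)"] Arg_bounded[of "cis x"] periodic_cis_cong[of f, OF assms(2) cis_Arg_cis, of x] by auto
  then show ?thesis by (rule that)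
qed

lemma periodic_deriv:
  fixes f f' :: "real \<Rightarrow> real"
  assumes "\<And>x. (f has_real_derivative f' x) (at x)" "\<And>x. f (x + p) = f x"
  shows "f' (x + p) = f' x"
proof -
  have "((\<lambda>x. f (x + p)) has_real_derivative f' (x + p)) (at x)"
    using assms(1) DERIV_shift by blast
  then show ?thesis
    using assms by (simp add: DERIV_unique)
qed

text \<open>The first three derivatives of W are continuous and periodic, hence bounded; the bound
  on the third is the Lipschitz constant of the second.\<close>

lemma Ck_imp_bounded_field:
  assumes "Ck_on_real 5 W" "\<And>x. W (x + 2 * pi) = W x"
  obtains C where "bounded_field (deriv W) (deriv (deriv W)) C"
proof -
  define D where "D j = (deriv ^^ j) W" for j
  have D: "(D j has_real_derivative D (Suc j) x) (at x)" if "j < 5" for j x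
  proof -
    have "D j differentiable (at x)" using assms(1) that by (simp add: Ck_on_real_def D_def)
    then show ?thesis
      using DERIV_deriv_iff_real_differentiable by (auto simp: D_def)
  qed
  have per: "D j (x + 2 * pi) = D j x" if "j \<le> 5" for j x
    using that
  proof (induction j arbitrary: x)
    case 0 then show ?case by (simp add: D_def assms)
  next
    case (Suc j) then show ?case using periodic_deriv[OF D] by simp
  qed
  have cont: "continuous_on UNIV (D j)" if "j < 5" for j
    using D[OF that] by (meson DERIV_isCont continuous_at_imp_continuous_on)
  obtain B1 where B1: "\<And>x. \<bar>D 1 x\<bar> \<le> B1" using periodic_bounded[OF cont[of 1] per[of 1]] by auto
  obtain B2 where B2: "\<And>x. \<bar>D 2 x\<bar> \<le> B2" using periodic_bounded[OF cont[of 2] per[of 2]] by auto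
  obtain B3 where B3: "\<And>x. \<bar>D 3 x\<bar> \<le> B3" using periodic_bounded[OF cont[of 3] per[of 3]] by auto
  define C where "C = max B1 (max B2 B3)"
  have C: "\<bar>D 1 x\<bar> \<le> C" "\<bar>D 2 x\<bar> \<le> C" "\<bar>D 3 x\<bar> \<le> C" for x
    using B1[of x] B2[of x] B3[of x] by (auto simp: C_def)
  have "bounded_field (D 1) (D 2) C"
  proof
    show "0 \<le> C" using C(1)[of 0] by linarith
    show "(D 1 has_real_derivative D 2 y) (at y)" for y using D[of 1] by (simp add: numeral_2_eq_2)
    show "\<bar>D 2 y - D 2 y'\<bar> \<le> C * \<bar>y - y'\<bar>" for y y'
      using field_differentiable_bound[of UNIV "D 2" "D 3" C y y'] D[of 2] C(3) by (auto simp: numeral_3_eq_3)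
  qed (use C per in auto)
  then show ?thesis
    by (intro that) (simp add: D_def numeral_2_eq_2)
qed

section \<open>Stationarity\<close>

lemma to_cylinder_from_cylinder:
  "u \<in> space cylinder_borel \<Longrightarrow> to_cylinder (from_cylinder u) = u"
  using cis_Arg[of "fst u"]
  by (cases "fst u = 0") (auto simp: space_cylinder_borel to_cylinder_def from_cylinder_def sgn_div_norm)

lemma borel_measurable_fst_snd:
  assumes "f \<in> borel_measurable N"
  shows "(\<lambda>x. fst (f x :: real \<times> real)) \<in> borel_measurable N" "(\<lambda>x. snd (f x)) \<in> borel_measurable N"
  using assms by (auto simp flip: borel_prod)

context bounded_field
begin

text \<open>The scheme descends to the cylinder. This reconciles the angles in [0, 2 pi) over which
  \<open>strip\<close> integrates with the branch \<open>Arg\<close> from which solutions are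
  started.\<close>

lemma to_cylinder_euler_cong:
  assumes "to_cylinder p = to_cylinder p'"
  shows "to_cylinder (euler w1 w2 h x k p) = to_cylinder (euler w1 w2 h x k p')"
proof (induction k)
  case 0
  then show ?case using assms by simp
next
  case (Suc k)
  define q q' where "q = euler w1 w2 h x k p" and "q' = euler w1 w2 h x k p'"
  have *: "cis (fst q) = cis (fst q')" "snd q = snd q'"
    using Suc by (auto simp: to_cylinder_def q_def q'_def)
  have cis: "cis (fst q + c) = cis (fst q' + c)" for c
    using * by (simp flip: cis_mult)
  have w: "w1 (fst q + c) = w1 (fst q' + c)" "w2 (fst q + c) = w2 (fst q' + c)" for c
    using periodic_cis_cong[of w1, OF w1_periodic cis] periodic_cis_cong[of w2, OF w2_periodic cis] by auto
  show ?case
    unfolding euler.simps q_def[symmetric] q'_def[symmetric]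
    by (simp add: to_cylinder_def euler_step_def w * cis flip: cis_mult)
qed

lemma measurable_euler_step [measurable]: "euler_step w1 w2 h \<in> measurable borel borel"
  using continuous_euler_step[of h 0] by (simp add: borel_measurable_continuous_onI)

lemma measurable_euler:
  assumes X: "\<And>j. x j \<in> borel_measurable N"
  shows "(\<lambda>q. euler w1 w2 h (\<lambda>j. x j (snd q)) k (fst q)) \<in> measurable (borel \<Otimes>\<^sub>M N) borel"
proof (induction k)
  case 0
  then show ?case by simp
next
  case (Suc k)
  note [measurable] = borel_measurable_fst_snd[OF Suc] X
  show ?case
    unfolding euler.simps by (rule measurable_compose[OF _ measurable_euler_step]) measurable
qed

end

text \<open>The null set in \<open>AE_solution_path\<close> may depend on the starting point, and no
  regularity of \<open>Y\<close> and \<open>S\<close> in (y, s) is assumed.\<close>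

locale noise_driven_flow = bounded_field + prob_space M for M :: "'a measure" +
  fixes X :: "real \<Rightarrow> 'a \<Rightarrow> real" and Y S :: "real \<Rightarrow> real \<Rightarrow> real \<Rightarrow> 'a \<Rightarrow> real"
  assumes measurable_X: "0 \<le> t \<Longrightarrow> X t \<in> borel_measurable M"
    and measurable_Y: "0 \<le> t \<Longrightarrow> Y y s t \<in> borel_measurable M"
    and measurable_S: "0 \<le> t \<Longrightarrow> S y s t \<in> borel_measurable M"
    and AE_solution_path:
      "AE \<omega> in M. solution_path w1 w2 C (\<lambda>t. X t \<omega>) (\<lambda>t. Y y s t \<omega>) (\<lambda>t. S y s t \<omega>) y s"
begin

definition approx :: "real \<Rightarrow> nat \<Rightarrow> (real \<times> real) \<times> 'a \<Rightarrow> real \<times> real" where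
  "approx t n q = euler w1 w2 (t / real (Suc n)) (\<lambda>k. X (real k * (t / real (Suc n))) (snd q)) (Suc n) (fst q)"

text \<open>\<open>lim\<close> is unspecified where the scheme diverges, which for each starting point is a null event.\<close>

definition flow :: "real \<Rightarrow> (real \<times> real) \<times> 'a \<Rightarrow> real \<times> real" where
  "flow t q = (lim (\<lambda>n. fst (approx t n q)), lim (\<lambda>n. snd (approx t n q)))"

definition cylinder_flow :: "real \<Rightarrow> (complex \<times> real) \<times> 'a \<Rightarrow> complex \<times> real" where
  "cylinder_flow t q = to_cylinder (flow t (from_cylinder (fst q), snd q))"

lemma measurable_approx:
  assumes "0 \<le> t"
  shows "approx t n \<in> measurable (borel \<Otimes>\<^sub>M M) borel"
  unfolding approx_def using assms by (intro measurable_euler measurable_X) auto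

lemma measurable_flow:
  assumes "0 \<le> t"
  shows "flow t \<in> measurable (borel \<Otimes>\<^sub>M M) borel"
proof -
  note [measurable] = borel_measurable_fst_snd[OF measurable_approx[OF assms]]
  show ?thesis unfolding flow_def by measurable
qed

lemma measurable_cylinder_flow:
  assumes "0 \<le> t"
  shows "cylinder_flow t \<in> measurable (cylinder_borel \<Otimes>\<^sub>M M) cylinder_borel"
proof -
  note [measurable] = measurable_flow[OF assms]
  show ?thesis unfolding cylinder_flow_def by measurable
qed

lemma AE_approx_LIMSEQ:
  assumes "0 \<le> t"
  shows "AE \<omega> in M. (\<lambda>n. approx t n ((y, s), \<omega>)) \<longlonglongrightarrow> (Y y s t \<omega>, S y s t \<omega>)"
  using AE_solution_path[of y s]
proof eventually_elim
  case (elim \<omega>)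
  then show ?case
    using solution_path.euler_LIMSEQ[OF elim assms] by (simp add: approx_def del: euler.simps)
qed

lemma AE_flow_eq:
  assumes "0 \<le> t"
  shows "AE \<omega> in M. flow t ((y, s), \<omega>) = (Y y s t \<omega>, S y s t \<omega>)"
  using AE_approx_LIMSEQ[OF assms, of y s]
proof eventually_elim
  case (elim \<omega>)
  then show ?case
    using tendsto_fst[OF elim] tendsto_snd[OF elim] by (simp add: flow_def limI)
qed

text \<open>For each starting point the limit of the scheme is almost surely the given solution, so
  the law is the same, now expressed by a jointly measurable map.\<close>

lemma cylinder_transition_eq:
  assumes "0 \<le> t" "u \<in> space cylinder_borel"
  shows "cylinder_transition M Y S t u = distr M cylinder_borel (\<lambda>\<omega>. cylinder_flow t (u, \<omega>))"
proof -
  obtain z s where u: "u = (z, s)" by (cases u)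
  have "distr M cylinder_borel (\<lambda>\<omega>. to_cylinder (Y (Arg z) s t \<omega>, S (Arg z) s t \<omega>)) =
      distr M cylinder_borel (\<lambda>\<omega>. cylinder_flow t (u, \<omega>))"
  proof (rule distr_cong_AE)
    show "AE \<omega> in M. to_cylinder (Y (Arg z) s t \<omega>, S (Arg z) s t \<omega>) = cylinder_flow t (u, \<omega>)"
      using AE_flow_eq[OF assms(1), of "Arg z" s]
      by eventually_elim (simp add: cylinder_flow_def from_cylinder_def u)
    have [measurable]: "Y (Arg z) s t \<in> borel_measurable M" "S (Arg z) s t \<in> borel_measurable M"
      using measurable_Y measurable_S assms by auto
    show "(\<lambda>\<omega>. to_cylinder (Y (Arg z) s t \<omega>, S (Arg z) s t \<omega>)) \<in> measurable M cylinder_borel"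
      by (rule measurable_compose[OF _ measurable_to_cylinder]) measurable
    show "(\<lambda>\<omega>. cylinder_flow t (u, \<omega>)) \<in> measurable M cylinder_borel"
      by (rule measurable_compose[OF measurable_Pair1'[OF assms(2)] measurable_cylinder_flow[OF assms(1)]])
  qed auto
  then show ?thesis
    by (simp add: cylinder_transition_def u to_cylinder_def)
qed

text \<open>The bound \<open>\<epsilon>\<close> is fixed before the realisation. It is the sum of
  \<open>Suc n\<close> one-step defects of order h^2, hence of order t h; it holds only eventually
  because the distortion estimate asks for a small step.\<close>

lemma approx_almost_invariant:
  fixes g :: "complex \<times> real \<Rightarrow> real"
  assumes "0 \<le> t" and g: "continuous_on UNIV g" "\<And>u. 0 \<le> g u \<and> g u \<le> 1" "bounded {u. g u \<noteq> 0}"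
  obtains \<epsilon> where "\<epsilon> \<longlonglongrightarrow> 0"
    and "eventually (\<lambda>n. \<forall>\<omega>. \<bar>(\<integral>p. g (to_cylinder (approx t n (p, \<omega>))) \<partial>strip) -
      (\<integral>p. g (to_cylinder p) \<partial>strip)\<bar> \<le> \<epsilon> n) sequentially"
proof -
  obtain R where R: "0 < R" "\<And>u. g u \<noteq> 0 \<Longrightarrow> norm u \<le> R"
    using g(3) unfolding bounded_pos by auto
  have test: "strip_test 1 R (\<lambda>p. g (to_cylinder p))"
    unfolding strip_test_def
  proof (intro conjI allI impI)
    show "continuous_on UNIV (\<lambda>p. g (to_cylinder p))"
      by (rule continuous_on_compose2[OF g(1) continuous_to_cylinder]) auto
    show "g (to_cylinder (y + 2 * pi, s)) = g (to_cylinder (y, s))" for y s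
      by (simp add: to_cylinder_def flip: cis_mult)
    show "\<bar>g (to_cylinder p)\<bar> \<le> 1" for p using g(2) by simp
    show "g (to_cylinder (y, s)) = 0" if "R < \<bar>s\<bar>" for y s
      using R(2)[of "to_cylinder (y, s)"] norm_snd_le[of s "cis y"] that
      by (auto simp: to_cylinder_def)
  qed
  define h where "h n = t / real (Suc n)" for n
  \<comment> \<open>The support radius in s after all steps: it grows by h C in each, and the steps
    have total length t.\<close>
  define R' where "R' = R + t * C"
  have h0: "h \<longlonglongrightarrow> 0"
    unfolding h_def using tendsto_mult[OF tendsto_const[of t] LIMSEQ_inverse_real_of_nat]
    by (simp add: divide_inverse)
  have "(\<lambda>n. h n * C * (R' + 1)) \<longlonglongrightarrow> 0 * C * (R' + 1)"
    by (intro tendsto_intros h0)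
  then have small: "eventually (\<lambda>n. h n * C * (R' + 1) < 1) sequentially"
    by (intro order_tendstoD(2)[of _ 0]) auto
  have nh: "real (Suc n) * h n = t" for n by (simp add: h_def)
  have "(\<lambda>n. t * ((R' + 1)\<^sup>2 * C\<^sup>2) * h n) \<longlonglongrightarrow> t * ((R' + 1)\<^sup>2 * C\<^sup>2) * 0"
    by (intro tendsto_intros h0)
  then have "(\<lambda>n. t * ((R' + 1)\<^sup>2 * C\<^sup>2) * h n) \<longlonglongrightarrow> 0" by simp
  moreover have "eventually (\<lambda>n. \<forall>\<omega>. \<bar>(\<integral>p. g (to_cylinder (approx t n (p, \<omega>))) \<partial>strip) -
      (\<integral>p. g (to_cylinder p) \<partial>strip)\<bar> \<le> t * ((R' + 1)\<^sup>2 * C\<^sup>2) * h n) sequentially"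
    using small
  proof eventually_elim
    case (elim n)
    have "real (Suc n) * (1 * ((R' + 1)\<^sup>2 * (h n * C)\<^sup>2)) = (real (Suc n) * h n) * ((R' + 1)\<^sup>2 * C\<^sup>2) * h n"
      by (simp only: power2_eq_square mult_ac mult_1_left)
    then have eq: "real (Suc n) * (1 * ((R' + 1)\<^sup>2 * (h n * C)\<^sup>2)) = t * ((R' + 1)\<^sup>2 * C\<^sup>2) * h n"
      by (simp only: nh)
    show ?case
    proof
      fix \<omega>
      show "\<bar>(\<integral>p. g (to_cylinder (approx t n (p, \<omega>))) \<partial>strip) - (\<integral>p. g (to_cylinder p) \<partial>strip)\<bar>
          \<le> t * ((R' + 1)\<^sup>2 * C\<^sup>2) * h n"
        unfolding approx_def fst_conv snd_conv h_def[symmetric] eq[symmetric]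
        using elim R(1) assms(1) nh[of n]
        by (intro euler_almost_invariant[OF test]) (auto simp: h_def R'_def)
    qed
  qed
  ultimately show ?thesis by (rule that)
qed

sublocale noise: pair_prob_space strip M
  by (simp add: pair_prob_space_def pair_sigma_finite_def prob_space_strip prob_space_axioms
      prob_space_imp_sigma_finite)

lemma measurable_strip_pair:
  assumes "f \<in> measurable (borel \<Otimes>\<^sub>M M) N"
  shows "f \<in> measurable (strip \<Otimes>\<^sub>M M) N"
proof -
  have "(\<lambda>q. (fst q, snd q)) \<in> measurable (strip \<Otimes>\<^sub>M M) (borel \<Otimes>\<^sub>M M)"
    by (intro measurable_Pair measurable_compose[OF measurable_fst measurable_strip] measurable_snd) simp
  then show ?thesis using assms by (auto dest: measurable_compose)
qed

text \<open>The integrals of \<open>F n\<close> over the product space are evaluated in both orders.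
  Realisations first, at fixed p, gives convergence to the integral of \<open>G\<close>; starting
  points first, at a fixed realisation, gives convergence to \<open>J\<close>.\<close>

lemma cylinder_flow_invariant:
  assumes t: "0 \<le> t"
  shows "distr (strip \<Otimes>\<^sub>M M) cylinder_borel (\<lambda>q. cylinder_flow t (to_cylinder (fst q), snd q)) = cylinder_gauss"
proof -
  define H where "H q = cylinder_flow t (to_cylinder (fst q), snd q)" for q
  have H: "H \<in> measurable (strip \<Otimes>\<^sub>M M) cylinder_borel"
  proof (rule measurable_strip_pair)
    note [measurable] = measurable_cylinder_flow[OF t]
    show "H \<in> measurable (borel \<Otimes>\<^sub>M M) cylinder_borel"
      unfolding H_def by measurable
  qed
  have "distr (strip \<Otimes>\<^sub>M M) cylinder_borel H = cylinder_gauss"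
  proof (rule cylinder_measure_eqI)
    show "finite_measure (distr (strip \<Otimes>\<^sub>M M) cylinder_borel H)"
      by (rule noise.P.finite_measure_distr[OF H])
    show "finite_measure cylinder_gauss"
      by (rule prob_space.finite_measure[OF prob_space_cylinder_gauss])
    fix g :: "complex \<times> real \<Rightarrow> real"
    assume g: "continuous_on UNIV g" "\<And>u. 0 \<le> g u \<and> g u \<le> 1" "bounded {u. g u \<noteq> 0}"
    have g_borel: "g \<in> borel_measurable borel"
      using g(1) by (rule borel_measurable_continuous_onI)
    have g_cyl: "g \<in> borel_measurable cylinder_borel"
      using measurable_compose[OF measurable_cylinder_borel_ident g_borel] .
    define F where "F n q = g (to_cylinder (approx t n q))" for n q
    define G where "G q = g (H q)" for q
    define J where "J = (\<integral>p. g (to_cylinder p) \<partial>strip)"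
    have F_meas: "F n \<in> borel_measurable (strip \<Otimes>\<^sub>M M)" for n
    proof (rule measurable_strip_pair)
      note [measurable] = g_cyl measurable_approx[OF t]
      show "F n \<in> borel_measurable (borel \<Otimes>\<^sub>M M)"
        unfolding F_def by measurable
    qed
    have G_meas: "G \<in> borel_measurable (strip \<Otimes>\<^sub>M M)"
      unfolding G_def using H g_cyl by (rule measurable_compose)
    have bounds: "\<bar>F n q\<bar> \<le> 1" "\<bar>G q\<bar> \<le> 1" for n q
      using g(2) by (auto simp: F_def G_def)
    have F_int: "integrable (strip \<Otimes>\<^sub>M M) (F n)" for n
      using F_meas bounds by (intro noise.P.integrable_const_bound[of _ 1]) auto
    have G_int: "integrable (strip \<Otimes>\<^sub>M M) G"
      using G_meas bounds by (intro noise.P.integrable_const_bound[of _ 1]) auto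
    have section_meas: "(\<lambda>\<omega>. F n (p, \<omega>)) \<in> borel_measurable M" "(\<lambda>\<omega>. G (p, \<omega>)) \<in> borel_measurable M"
      if "p \<in> space strip" for p n
      using measurable_compose[OF measurable_Pair1'[OF that] F_meas]
        measurable_compose[OF measurable_Pair1'[OF that] G_meas] by auto
    have inner: "(\<lambda>n. \<integral>\<omega>. F n (p, \<omega>) \<partial>M) \<longlonglongrightarrow> (\<integral>\<omega>. G (p, \<omega>) \<partial>M)" if p: "p \<in> space strip" for p
    proof (rule integral_dominated_convergence[where w="\<lambda>_. 1"])
      \<comment> \<open>The flow is started from the representative (y, s) chosen by
        \<open>Arg\<close>, which may differ from p by a full turn of the angle.\<close>
      obtain y s where ys: "from_cylinder (to_cylinder p) = (y, s)" by fastforce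
      have "to_cylinder p \<in> space cylinder_borel"
        by (auto simp: space_cylinder_borel to_cylinder_def)
      then have cong: "to_cylinder p = to_cylinder (y, s)"
        using to_cylinder_from_cylinder ys by metis
      have F_eq: "F n (p, \<omega>) = F n ((y, s), \<omega>)" for n \<omega>
        unfolding F_def approx_def fst_conv snd_conv by (subst to_cylinder_euler_cong[OF cong]) simp
      show "AE \<omega> in M. (\<lambda>n. F n (p, \<omega>)) \<longlonglongrightarrow> G (p, \<omega>)"
        using AE_approx_LIMSEQ[OF t, of y s] AE_flow_eq[OF t, of y s]
      proof eventually_elim
        case (elim \<omega>)
        have "isCont (\<lambda>r. g (to_cylinder r)) r" for r
          using continuous_on_compose2[OF g(1) continuous_to_cylinder[of UNIV]]
          unfolding continuous_on_eq_continuous_at[OF open_UNIV] by blast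
        from isCont_tendsto_compose[OF this elim(1)] show ?case
          unfolding F_eq G_def H_def cylinder_flow_def fst_conv snd_conv ys elim(2) by (simp add: F_def)
      qed
    qed (use bounds section_meas[OF p] in auto)
    have "(\<lambda>n. \<integral>p. \<integral>\<omega>. F n (p, \<omega>) \<partial>M \<partial>strip) \<longlonglongrightarrow> (\<integral>p. \<integral>\<omega>. G (p, \<omega>) \<partial>M \<partial>strip)"
    proof (rule integral_dominated_convergence[where w="\<lambda>_. 1"])
      show "(\<lambda>p. \<integral>\<omega>. F n (p, \<omega>) \<partial>M) \<in> borel_measurable strip" for n
        using noise.integrable_fst'[OF F_int] by (rule borel_measurable_integrable)
      show "(\<lambda>p. \<integral>\<omega>. G (p, \<omega>) \<partial>M) \<in> borel_measurable strip"
        using noise.integrable_fst'[OF G_int] by (rule borel_measurable_integrable)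
      show "AE p in strip. (\<lambda>n. \<integral>\<omega>. F n (p, \<omega>) \<partial>M) \<longlonglongrightarrow> (\<integral>\<omega>. G (p, \<omega>) \<partial>M)"
        by (rule AE_I2) (rule inner)
      show "AE p in strip. norm (\<integral>\<omega>. F n (p, \<omega>) \<partial>M) \<le> 1" for n
      proof (rule AE_I2)
        fix p assume p: "p \<in> space strip"
        have "integrable M (\<lambda>\<omega>. F n (p, \<omega>))"
          using section_meas[OF p] bounds by (intro integrable_const_bound[of _ 1]) auto
        then have "(\<integral>\<omega>. \<bar>F n (p, \<omega>)\<bar> \<partial>M) \<le> 1"
          using bounds by (intro integral_le_const) auto
        with integral_norm_bound[of M "\<lambda>\<omega>. F n (p, \<omega>)"]
        show "norm (\<integral>\<omega>. F n (p, \<omega>) \<partial>M) \<le> 1"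
          unfolding real_norm_def by (rule order_trans)
      qed
    qed simp
    then have lim_G: "(\<lambda>n. \<integral>q. F n q \<partial>(strip \<Otimes>\<^sub>M M)) \<longlonglongrightarrow> (\<integral>q. G q \<partial>(strip \<Otimes>\<^sub>M M))"
      by (simp add: noise.integral_fst'[OF F_int] noise.integral_fst'[OF G_int])
    have lim_J: "(\<lambda>n. \<integral>q. F n q \<partial>(strip \<Otimes>\<^sub>M M)) \<longlonglongrightarrow> J"
    proof -
      obtain \<epsilon> where \<epsilon>: "\<epsilon> \<longlonglongrightarrow> 0"
        and F_J: "eventually (\<lambda>n. \<forall>\<omega>. \<bar>(\<integral>p. F n (p, \<omega>) \<partial>strip) - J\<bar> \<le> \<epsilon> n) sequentially"
        unfolding F_def J_def by (rule approx_almost_invariant[OF t g])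
      have "eventually (\<lambda>n. norm ((\<integral>q. F n q \<partial>(strip \<Otimes>\<^sub>M M)) - J) \<le> \<epsilon> n) sequentially"
        using F_J
      proof eventually_elim
        case (elim n)
        have F_int': "integrable (strip \<Otimes>\<^sub>M M) (case_prod (\<lambda>p \<omega>. F n (p, \<omega>)))"
          using F_int by simp
        have int: "integrable M (\<lambda>\<omega>. \<integral>p. F n (p, \<omega>) \<partial>strip)"
          using noise.integrable_snd[OF F_int'] .
        have "(\<integral>q. F n q \<partial>(strip \<Otimes>\<^sub>M M)) = (\<integral>\<omega>. \<integral>p. F n (p, \<omega>) \<partial>strip \<partial>M)"
          using noise.integral_snd[OF F_int'] by simp
        then have "(\<integral>q. F n q \<partial>(strip \<Otimes>\<^sub>M M)) - J = (\<integral>\<omega>. (\<integral>p. F n (p, \<omega>) \<partial>strip) - J \<partial>M)"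
          using int by (simp add: prob_space)
        also have "norm \<dots> \<le> (\<integral>\<omega>. norm ((\<integral>p. F n (p, \<omega>) \<partial>strip) - J) \<partial>M)"
          by (rule integral_norm_bound)
        also have "\<dots> \<le> \<epsilon> n"
          using int elim by (intro integral_le_const) auto
        finally show ?case .
      qed
      then show ?thesis
        by (rule LIM_zero_cancel[OF Lim_null_comparison[OF _ \<epsilon>]])
    qed
    have "(\<integral>q. G q \<partial>(strip \<Otimes>\<^sub>M M)) = J"
      using LIMSEQ_unique[OF lim_G lim_J] .
    then show "(\<integral>u. g u \<partial>distr (strip \<Otimes>\<^sub>M M) cylinder_borel H) = (\<integral>u. g u \<partial>cylinder_gauss)"
      by (simp add: integral_distr[OF H g_cyl] G_def J_def cylinder_gauss_eq
          integral_distr[OF measurable_strip_to_cylinder g_cyl])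
  qed (simp_all add: sets_cylinder_gauss)
  then show ?thesis by (simp add: H_def[abs_def])
qed

lemma stationary: "stationary_distribution cylinder_borel (cylinder_transition M Y S) cylinder_gauss"
  unfolding stationary_distribution_def
proof (intro conjI allI impI ballI prob_space_cylinder_gauss sets_cylinder_gauss)
  fix t :: real and B assume t: "0 \<le> t" and B: "B \<in> sets cylinder_borel"
  \<comment> \<open>The transition probabilities into \<open>B\<close> are the measures of the
    sections of this one product set; measurability in the starting point is then part of Fubini's
    theorem.\<close>
  define Q where "Q = cylinder_flow t -` B \<inter> space (cylinder_borel \<Otimes>\<^sub>M M)"
  have Q: "Q \<in> sets (cylinder_borel \<Otimes>\<^sub>M M)"
    unfolding Q_def using measurable_cylinder_flow[OF t] B by (rule measurable_sets)
  have P_eq: "emeasure (cylinder_transition M Y S t u) B = emeasure M (Pair u -` Q)"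
    if u: "u \<in> space cylinder_borel" for u
  proof -
    have "(\<lambda>\<omega>. cylinder_flow t (u, \<omega>)) \<in> measurable M cylinder_borel"
      by (rule measurable_compose[OF measurable_Pair1'[OF u] measurable_cylinder_flow[OF t]])
    then show ?thesis
      using u B unfolding cylinder_transition_eq[OF t u]
      by (subst emeasure_distr) (auto simp: Q_def space_pair_measure intro!: arg_cong[where f="emeasure M"])
  qed
  have "(\<lambda>u. emeasure M (Pair u -` Q)) \<in> borel_measurable cylinder_borel"
    using Q by (rule measurable_emeasure_Pair)
  then show meas: "(\<lambda>u. emeasure (cylinder_transition M Y S t u) B) \<in> borel_measurable cylinder_borel"
    using P_eq by (simp cong: measurable_cong)
  have map: "(\<lambda>q. (to_cylinder (fst q), snd q)) \<in> measurable (strip \<Otimes>\<^sub>M M) (cylinder_borel \<Otimes>\<^sub>M M)"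
    by (intro measurable_Pair measurable_compose[OF measurable_fst measurable_strip_to_cylinder] measurable_snd)
  define Q' where "Q' = (\<lambda>q. (to_cylinder (fst q), snd q)) -` Q \<inter> space (strip \<Otimes>\<^sub>M M)"
  have Q': "Q' \<in> sets (strip \<Otimes>\<^sub>M M)"
    unfolding Q'_def using map Q by (rule measurable_sets)
  have "(\<integral>\<^sup>+u. emeasure (cylinder_transition M Y S t u) B \<partial>cylinder_gauss) =
      (\<integral>\<^sup>+p. emeasure (cylinder_transition M Y S t (to_cylinder p)) B \<partial>strip)"
    unfolding cylinder_gauss_eq using meas
    by (intro nn_integral_distr measurable_strip_to_cylinder) simp
  also have "\<dots> = (\<integral>\<^sup>+p. emeasure M (Pair p -` Q') \<partial>strip)"
  proof (rule nn_integral_cong)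
    fix p assume p: "p \<in> space strip"
    have "to_cylinder p \<in> space cylinder_borel"
      by (auto simp: space_cylinder_borel to_cylinder_def)
    moreover have "Pair (to_cylinder p) -` Q = Pair p -` Q'"
      using p by (auto simp: Q'_def Q_def space_pair_measure)
    ultimately show "emeasure (cylinder_transition M Y S t (to_cylinder p)) B = emeasure M (Pair p -` Q')"
      by (simp add: P_eq)
  qed
  also have "\<dots> = emeasure (strip \<Otimes>\<^sub>M M) Q'"
    by (rule emeasure_pair_measure_alt[OF Q', symmetric])
  also have "\<dots> = emeasure (distr (strip \<Otimes>\<^sub>M M) cylinder_borel
      (\<lambda>q. cylinder_flow t (to_cylinder (fst q), snd q))) B"
  proof (subst emeasure_distr[OF measurable_compose[OF map measurable_cylinder_flow[OF t]] B])
    show "emeasure (strip \<Otimes>\<^sub>M M) Q' = emeasure (strip \<Otimes>\<^sub>M M)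
        ((\<lambda>q. cylinder_flow t (to_cylinder (fst q), snd q)) -` B \<inter> space (strip \<Otimes>\<^sub>M M))"
      using measurable_space[OF map]
      by (intro arg_cong[where f="emeasure (strip \<Otimes>\<^sub>M M)"]) (auto simp: Q'_def Q_def)
  qed
  also have "\<dots> = emeasure cylinder_gauss B"
    by (simp add: cylinder_flow_invariant[OF t])
  finally show "(\<integral>\<^sup>+u. emeasure (cylinder_transition M Y S t u) B \<partial>cylinder_gauss) = emeasure cylinder_gauss B" .
qed

end

theorem theorem2p11:
  fixes \<alpha> :: real
    and V :: "complex \<Rightarrow> real"
    and W :: "real \<Rightarrow> real"
    and M :: "'a measure"
    and X :: "real \<Rightarrow> 'a \<Rightarrow> real"
    and Y S :: "real \<Rightarrow> real \<Rightarrow> real \<Rightarrow> 'a \<Rightarrow> real"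
  assumes "0 < \<alpha>" and "\<alpha> < 2"
    and "\<And>x. W x = V (cis x)"
    and "Ck_on_real 5 W"
    and "\<not> V constant_on (sphere 0 1)"
    and "symmetric_stable_process \<alpha> M X"
    and "\<And>y s. sde_solution M X W y s (Y y s) (S y s)"
  shows "stationary_distribution cylinder_borel (cylinder_transition M Y S) cylinder_gauss"
proof -
  have "W (x + 2 * pi) = W x" for x
    using assms(3) by (simp flip: cis_mult)
  then obtain C where C: "bounded_field (deriv W) (deriv (deriv W)) C"
    using Ck_imp_bounded_field[OF assms(4)] by blast
  have levy: "levy_process M X"
    using assms(6) by (simp add: symmetric_stable_process_def levy_process_with_triplet_def)
  interpret noise_driven_flow "deriv W" "deriv (deriv W)" C M X Y S
  proof (intro noise_driven_flow.intro C noise_driven_flow_axioms.intro)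
    show "prob_space M" using levy by (simp add: levy_process_def)
    show "X t \<in> borel_measurable M" if "0 \<le> t" for t
      using levy that by (simp add: levy_process_def)
    show "Y y s t \<in> borel_measurable M" "S y s t \<in> borel_measurable M" if "0 \<le> t" for y s t
      using assms(7)[of y s] that by (auto simp: sde_solution_def)
    fix y s
    have "AE \<omega> in M. X 0 \<omega> = 0" using levy by (simp add: levy_process_def)
    moreover have "AE \<omega> in M. cadlag (\<lambda>t. Y y s t \<omega>) \<and> cadlag (\<lambda>t. S y s t \<omega>)"
      using assms(7)[of y s] by (simp add: sde_solution_def)
    moreover have "AE \<omega> in M. \<forall>t\<ge>0.
        ((\<lambda>r. deriv W (Y y s r \<omega>) * S y s r \<omega>) has_integral (Y y s t \<omega> - y - X t \<omega>)) {0..t} \<and>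
        ((\<lambda>r. deriv (deriv W) (Y y s r \<omega>)) has_integral (S y s t \<omega> - s)) {0..t}"
      using assms(7)[of y s] by (simp add: sde_solution_def)
    ultimately show "AE \<omega> in M. solution_path (deriv W) (deriv (deriv W)) C
        (\<lambda>t. X t \<omega>) (\<lambda>t. Y y s t \<omega>) (\<lambda>t. S y s t \<omega>) y s"
      by eventually_elim
        (auto intro!: solution_path.intro C solution_path_axioms.intro simp: cadlag_def)
  qed
  show ?thesis by (rule stationary)
qed

end
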